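(* Let a directed graph IFS on $\mathbb{R}^n$ satisfying the open set condition be given, with attractors $(F_u)_{u\in V}$, and let $s=\dim_{\rm H}F_u$ (this value is the same for all $u\in V$). Then for every $u\in V$: (a) $\mathcal{H}^s(A)\leq |A|^s$ for all $\mathcal{H}^s$-measurable subsets $A\subset F_u$; (b) $\displaystyle \sup\left\{\frac{\mathcal{H}^s(A)}{|A|^s} : A \text{ is } \mathcal{H}^s\text{-measurable},\ A\subset F_u\right\}=1$.
   Context: Directed graph IFS on $\mathbb{R}^n$: a finite directed graph with vertex set $V$ and edge set $E^1$ (loops and multiple edges allowed), each edge $e$ having initial vertex $i(e)$ and terminal vertex $t(e)$; the graph is strongly connected (there is a directed path from any vertex to any vertex) and every vertex has at least two edges leaving it. Each edge $e$ carries a contracting similarity $S_e:\mathbb{R}^n\to\mathbb{R}^n$ with ratio $r_e\in(0,1)$. $E_u^1$ is the set of edges with initial vertex $u$, and $E_{uv}^1$ the set of edges from $u$ to $v$. The attractors $(F_u)_{u\in V}$ are the unique non-empty compact sets $F_u\subset\mathbb{R}^n$ with $F_u=\bigcup_{e\in E_u^1}S_e(F_{t(e)})$ for all $u\in V$. Open set condition (OSC): there exist non-empty bounded open sets $(U_u)_{u\in V}$ in $\mathbb{R}^n$ such that for each $u\in V$, $S_e(U_{t(e)})\subset U_u$ for all $e\in E_u^1$ and $S_e(U_{t(e)})\cap S_f(U_{t(f)})=\emptyset$ for all distinct $e,f\in E_u^1$. Known background: under the OSC, $s=\dim_{\rm H}F_u$ for every $u\in V$, where $s$ is the unique non-negative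 real such that the $\#V\times\#V$ matrix $\mathbf{A}(s)$ with $uv$-th entry $\sum_{e\in E_{uv}^1}r_e^s$ has spectral radius $1$, and $0<\mathcal{H}^s(F_u)<+\infty$. $\mathcal{H}^s$ is $s$-dimensional Hausdorff measure, normalised as $\mathcal{H}^s(A)=\lim_{\delta\to0}\inf\{\sum_i|U_i|^s: \{U_i\} \text{ a countable cover of } A,\ |U_i|\leq\delta\}$; $|A|$ is the diameter of $A$. The quotient in (b) is considered for sets with $|A|>0$. *)

theory Defs
  imports "Graph_Theory.Digraph_Component" "HOL-Analysis.Analysis"
begin

section \<open>Hausdorff measure and dimension\<close>

text \<open>
  The summand \<open>|U|\<^sup>s\<close>. Isabelle has \<open>0 powr 0 = 0\<close>, whereas for \<open>s = 0\<close> every non-empty set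
  has to count as 1, so that the 0-dimensional measure is counting measure. The empty set
  always contributes 0, which lets finite covers be padded to sequences.
\<close>

definition diam_power :: "real \<Rightarrow> 'a::metric_space set \<Rightarrow> ennreal" where
  "diam_power s U = (if U = {} then 0 else if s = 0 then 1 else ennreal (diameter U powr s))"

text \<open>
  Boundedness is required explicitly because \<^const>\<open>diameter\<close> is real-valued and
  carries no information for unbounded sets.
\<close>

definition delta_covers :: "real \<Rightarrow> 'a::metric_space set \<Rightarrow> (nat \<Rightarrow> 'a set) set" where
  "delta_covers \<delta> A = {U. A \<subseteq> (\<Union>i. U i) \<and> (\<forall>i. bounded (U i) \<and> diameter (U i) \<le> \<delta>)}"

definition hausdorff_content :: "real \<Rightarrow> real \<Rightarrow> 'a::metric_space set \<Rightarrow> ennreal" where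
  "hausdorff_content s \<delta> A = (INF U\<in>delta_covers \<delta> A. \<Sum>i. diam_power s (U i))"

definition hausdorff_measure :: "real \<Rightarrow> 'a::metric_space set \<Rightarrow> ennreal" where
  "hausdorff_measure s A = Lim (at_right 0) (\<lambda>\<delta>. hausdorff_content s \<delta> A)"

lemma hausdorff_content_antimono:
  assumes "\<delta> \<le> \<epsilon>"
  shows "hausdorff_content s \<epsilon> A \<le> hausdorff_content s \<delta> A"
  unfolding hausdorff_content_def
  by (rule INF_superset_mono) (use assms in \<open>auto simp: delta_covers_def intro: order_trans\<close>)

lemma hausdorff_content_tendsto_SUP:
  "((\<lambda>\<delta>. hausdorff_content s \<delta> A) \<longlongrightarrow> (SUP \<delta>\<in>{0<..}. hausdorff_content s \<delta> A)) (at_right 0)"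
proof (rule order_tendstoI)
  fix a assume "a < (SUP \<delta>\<in>{0<..}. hausdorff_content s \<delta> A)"
  then obtain \<epsilon> where \<epsilon>: "\<epsilon> > 0" "a < hausdorff_content s \<epsilon> A"
    by (auto simp: less_SUP_iff)
  show "eventually (\<lambda>\<delta>. a < hausdorff_content s \<delta> A) (at_right 0)"
    unfolding eventually_at_right_field
    using \<epsilon> less_le_trans[OF _ hausdorff_content_antimono] by (metis less_imp_le)
next
  fix a assume "(SUP \<delta>\<in>{0<..}. hausdorff_content s \<delta> A) < a"
  then have "hausdorff_content s \<delta> A < a" if "\<delta> > 0" for \<delta>
    using that by (meson SUP_upper greaterThan_iff le_less_trans)
  then show "eventually (\<lambda>\<delta>. hausdorff_content s \<delta> A < a) (at_right 0)"
    by (simp add: eventually_at_filter)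
qed

lemma hausdorff_measure_eq_SUP:
  "hausdorff_measure s A = (SUP \<delta>\<in>{0<..}. hausdorff_content s \<delta> A)"
  unfolding hausdorff_measure_def
  by (rule tendsto_Lim[OF _ hausdorff_content_tendsto_SUP]) simp

text \<open>Measurability in the sense of Caratheodory, for the outer measure above.\<close>

definition hausdorff_measurable :: "real \<Rightarrow> 'a::metric_space set \<Rightarrow> bool" where
  "hausdorff_measurable s A \<longleftrightarrow> A \<in> lambda_system UNIV UNIV (hausdorff_measure s)"

text \<open>
  Real-valued, hence restricted to Euclidean spaces: there the set below contains every
  \<open>t > DIM('a)\<close>, so that the infimum is a genuine one.
\<close>

definition hausdorff_dim :: "'a::euclidean_space set \<Rightarrow> real" where
  "hausdorff_dim A = Inf {t. 0 \<le> t \<and> hausdorff_measure t A = 0}"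


section \<open>Directed graph iterated function systems\<close>

text \<open>
  The initial and terminal vertex of an edge \<open>e\<close> are \<open>tail G e\<close> and \<open>head G e\<close>.
\<close>

locale digraph_IFS = fin_digraph G
  for G :: "('v, 'e) pre_digraph" +
  fixes S :: "'e \<Rightarrow> real ^ 'n \<Rightarrow> real ^ 'n" and r :: "'e \<Rightarrow> real"
  assumes strongly_connected: "strongly_connected G"
    and out_degree_ge_2: "u \<in> verts G \<Longrightarrow> out_degree G u \<ge> 2"
    and ratio_pos: "e \<in> arcs G \<Longrightarrow> 0 < r e"
    and ratio_less_1: "e \<in> arcs G \<Longrightarrow> r e < 1"
    and similarity: "e \<in> arcs G \<Longrightarrow> dist (S e x) (S e y) = r e * dist x y"

definition is_attractor ::
  "('v, 'e) pre_digraph \<Rightarrow> ('e \<Rightarrow> real ^ 'n \<Rightarrow> real ^ 'n) \<Rightarrow> ('v \<Rightarrow> (real ^ 'n) set) \<Rightarrow> bool" where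
  "is_attractor G S F \<longleftrightarrow>
     (\<forall>u\<in>verts G. F u \<noteq> {} \<and> compact (F u) \<and> F u = (\<Union>e\<in>out_arcs G u. S e ` F (head G e)))"

definition open_set_condition ::
  "('v, 'e) pre_digraph \<Rightarrow> ('e \<Rightarrow> real ^ 'n \<Rightarrow> real ^ 'n) \<Rightarrow> bool" where
  "open_set_condition G S \<longleftrightarrow>
     (\<exists>U. \<forall>u\<in>verts G.
        U u \<noteq> {} \<and> bounded (U u) \<and> open (U u) \<and>
        (\<forall>e\<in>out_arcs G u. S e ` U (head G e) \<subseteq> U u) \<and>
        (\<forall>e\<in>out_arcs G u. \<forall>f\<in>out_arcs G u.
           e \<noteq> f \<longrightarrow> S e ` U (head G e) \<inter> S f ` U (head G f) = {}))"

end

theory Submission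
  imports Defs
begin

text \<open>
  The heart of the matter is that, at the critical exponent, covering an attractor economically
  does not require small sets. Write \<open>c\<^sub>u\<close> for the Hausdorff content of \<open>F\<^sub>u\<close> at a scale \<open>D > 0\<close> that
  is at least as large as the diameters of all attractors. The equation \<open>F\<^sub>u = \<Union>\<^sub>e S\<^sub>e(F\<^sub>t\<^sub>(\<^sub>e\<^sub>))\<close> gives
  \<open>c\<^sub>u \<le> \<Sum>\<^sub>e r\<^sub>e\<^sup>s c\<^sub>t\<^sub>(\<^sub>e\<^sub>)\<close>. If there are positive weights \<open>h\<close> with
  \<open>h\<^sub>u = \<Sum>\<^sub>e r\<^sub>e\<^sup>s h\<^sub>t\<^sub>(\<^sub>e\<^sub>)\<close>, a maximum principle on the strongly connected graph forces
  \<open>c\<close> to be a multiple of \<open>h\<close>, so that the inequality is an equality. Transporting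
  covers of scale \<open>D\<close> down the graph then produces covers of arbitrarily small scale without any
  increase of the sum of the \<open>s\<close>-th powers of the diameters. Hence the Hausdorff measure of
  \<open>F\<^sub>u\<close> equals its content \<open>c\<^sub>u\<close> (\<open>hausdorff_measure_eq_content\<close>); in particular it is finite.

  Part (a) follows by counting one set as a single covering set: for measurable
  \<open>A \<subseteq> F\<^sub>u\<close>, the measures of \<open>A\<close> and \<open>F\<^sub>u - A\<close> add up to the content of \<open>F\<^sub>u\<close>, which is at most
  \<open>|A|\<^sup>s\<close> plus the measure of \<open>F\<^sub>u - A\<close>, and the latter can be cancelled. For part (b), if the
  supremum were \<open>\<sigma> < 1\<close>, then intersecting \<open>F\<^sub>u\<close> with the closures of the sets of a cover would
  bound the measure of \<open>F\<^sub>u\<close> by \<open>\<sigma>\<close> times its content, hence by \<open>\<sigma>\<close> times itself, which is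
  impossible for a positive finite number (\<open>SUP_density_ge_1\<close>). This step uses that closed sets
  are measurable.

  Two ingredients remain. The weights \<open>h\<close> and the exponent \<open>s\<close> are found by maximising the
  exponent \<open>t\<close> over all pairs \<open>(t, h)\<close> with \<open>h\<^sub>u \<le> \<Sum>\<^sub>e r\<^sub>e\<^sup>t h\<^sub>t\<^sub>(\<^sub>e\<^sub>)\<close>: at the maximum no inequality
  can be strict (\<open>ex_invariant_weights\<close>). The open set condition makes the measure positive
  (\<open>weight_le_ball_cover\<close>): the \<open>h\<close>-mass that a ball of radius \<open>\<rho>\<close> can receive is at most a
  constant times \<open>\<rho>\<^sup>s\<close>, because the volume of \<open>U\<^sub>u\<close> near the ball is shared by disjoint similar
  copies of the sets \<open>U\<^sub>v\<close>. A positive and finite \<open>s\<close>-dimensional measure identifies \<open>s\<close> as the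
  Hausdorff dimension.
\<close>

section \<open>Hausdorff content and Hausdorff measure as outer measures\<close>

lemma hausdorff_content_mono:
  assumes "A \<subseteq> B"
  shows "hausdorff_content s \<delta> A \<le> hausdorff_content s \<delta> B"
  unfolding hausdorff_content_def
  by (rule INF_superset_mono) (use assms in \<open>auto simp: delta_covers_def\<close>)

lemma hausdorff_content_le_diam_power:
  assumes "bounded A" "diameter A \<le> \<delta>" "0 \<le> \<delta>"
  shows "hausdorff_content s \<delta> A \<le> diam_power s A"
proof -
  define U where "U i = (if i = (0::nat) then A else {})" for i
  have "U \<in> delta_covers \<delta> A"
    using assms by (auto simp: delta_covers_def U_def split: if_splits)
  then have "hausdorff_content s \<delta> A \<le> (\<Sum>i. diam_power s (U i))"
    unfolding hausdorff_content_def by (rule INF_lower)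
  also have "\<dots> = (\<Sum>i\<in>{0}. diam_power s (U i))"
    by (rule suminf_finite) (auto simp: U_def diam_power_def)
  finally show ?thesis by (simp add: U_def)
qed

lemma hausdorff_content_UN_le:
  "hausdorff_content s \<delta> (\<Union>i::nat. A i) \<le> (\<Sum>i. hausdorff_content s \<delta> (A i))"
proof (rule ennreal_le_epsilon)
  fix e :: real
  assume fin: "(\<Sum>i. hausdorff_content s \<delta> (A i)) < top" and e: "0 < e"
  have "\<exists>U\<in>delta_covers \<delta> (A i). (\<Sum>j. diam_power s (U j))
          < hausdorff_content s \<delta> (A i) + ennreal (e * (1/2)^Suc i)" for i
  proof (rule INF_approx_ennreal)
    show "hausdorff_content s \<delta> (A i) \<noteq> \<infinity>"
      using ennreal_suminf_lessD[OF fin, of i] by auto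
  qed (use e in \<open>auto simp: hausdorff_content_def\<close>)
  then obtain U where U: "\<And>i. U i \<in> delta_covers \<delta> (A i)"
    and le: "\<And>i. (\<Sum>j. diam_power s (U i j))
               < hausdorff_content s \<delta> (A i) + ennreal (e * (1/2)^Suc i)"
    by metis
  define V where "V k = (case prod_decode k of (i, j) \<Rightarrow> U i j)" for k
  have "\<exists>k. x \<in> V k" if "x \<in> A i" for x i
  proof -
    obtain j where "x \<in> U i j"
      using U[of i] \<open>x \<in> A i\<close> by (auto simp: delta_covers_def)
    then have "x \<in> V (prod_encode (i, j))" by (simp add: V_def)
    then show ?thesis ..
  qed
  moreover have "bounded (V k) \<and> diameter (V k) \<le> \<delta>" for k
    using U by (auto simp: V_def delta_covers_def split: prod.split)
  ultimately have "V \<in> delta_covers \<delta> (\<Union>i. A i)"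
    by (auto simp: delta_covers_def)
  then have "hausdorff_content s \<delta> (\<Union>i. A i) \<le> (\<Sum>k. diam_power s (V k))"
    unfolding hausdorff_content_def by (rule INF_lower)
  also have "\<dots> = (\<Sum>k. (\<lambda>(i, j). diam_power s (U i j)) (prod_decode k))"
    by (simp add: V_def split_def)
  also have "\<dots> = (\<Sum>i. \<Sum>j. diam_power s (U i j))"
    by (rule suminf_ennreal_2dimen) simp
  also have "\<dots> \<le> (\<Sum>i. hausdorff_content s \<delta> (A i) + ennreal (e * (1/2)^Suc i))"
    by (intro suminf_le less_imp_le le) auto
  also have "\<dots> = (\<Sum>i. hausdorff_content s \<delta> (A i)) + (\<Sum>i. ennreal (e * (1/2)^Suc i))"
    by (rule suminf_add[symmetric]) auto
  also have "(\<Sum>i. ennreal (e * (1/2)^Suc i)) = ennreal e"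
    using sums_mult[OF power_half_series, of e] e by (intro suminf_ennreal_eq) auto
  finally show "hausdorff_content s \<delta> (\<Union>i. A i) \<le> (\<Sum>i. hausdorff_content s \<delta> (A i)) + ennreal e" .
qed

lemma hausdorff_content_empty [simp]: "hausdorff_content s \<delta> {} = 0" if "0 \<le> \<delta>"
  using hausdorff_content_le_diam_power[of "{}" \<delta> s] that by (simp add: diam_power_def)

lemma hausdorff_content_UN_finite_le:
  assumes "finite I" "0 \<le> \<delta>"
  shows "hausdorff_content s \<delta> (\<Union>i\<in>I. A i) \<le> (\<Sum>i\<in>I. hausdorff_content s \<delta> (A i))"
  using \<open>finite I\<close>
proof (induction I rule: finite_induct)
  case empty
  then show ?case using \<open>0 \<le> \<delta>\<close> by simp
next
  case (insert a I)
  have eq: "(\<Union>i\<in>insert a I. A i) = (\<Union>n. binaryset (A a) (\<Union>i\<in>I. A i) n)"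
    by (simp add: UN_binaryset_eq)
  have "hausdorff_content s \<delta> (\<Union>i\<in>insert a I. A i)
      \<le> (\<Sum>n. hausdorff_content s \<delta> (binaryset (A a) (\<Union>i\<in>I. A i) n))"
    unfolding eq by (rule hausdorff_content_UN_le)
  also have "\<dots> = hausdorff_content s \<delta> (A a) + hausdorff_content s \<delta> (\<Union>i\<in>I. A i)"
    using \<open>0 \<le> \<delta>\<close> by (intro suminf_binaryset_eq) simp
  finally show ?case
    using insert by (auto intro: order_trans add_left_mono)
qed

lemma hausdorff_content_le_measure:
  "0 < \<delta> \<Longrightarrow> hausdorff_content s \<delta> A \<le> hausdorff_measure s A"
  unfolding hausdorff_measure_eq_SUP by (rule SUP_upper) simp

lemma hausdorff_measure_leI:
  "(\<And>\<delta>. 0 < \<delta> \<Longrightarrow> hausdorff_content s \<delta> A \<le> c) \<Longrightarrow> hausdorff_measure s A \<le> c"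
  unfolding hausdorff_measure_eq_SUP by (rule SUP_least) simp

lemma hausdorff_measure_mono: "A \<subseteq> B \<Longrightarrow> hausdorff_measure s A \<le> hausdorff_measure s B"
  by (meson hausdorff_content_le_measure hausdorff_content_mono hausdorff_measure_leI order_trans)

lemma hausdorff_measure_empty [simp]: "hausdorff_measure s {} = 0"
  by (simp add: hausdorff_measure_eq_SUP)

lemma hausdorff_measure_UN_le:
  "hausdorff_measure s (\<Union>i::nat. A i) \<le> (\<Sum>i. hausdorff_measure s (A i))"
proof (rule hausdorff_measure_leI)
  fix \<delta> :: real assume "0 < \<delta>"
  then have "(\<Sum>i. hausdorff_content s \<delta> (A i)) \<le> (\<Sum>i. hausdorff_measure s (A i))"
    by (intro suminf_le hausdorff_content_le_measure) auto
  then show "hausdorff_content s \<delta> (\<Union>i. A i) \<le> (\<Sum>i. hausdorff_measure s (A i))"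
    using hausdorff_content_UN_le order_trans by blast
qed

lemma hausdorff_measure_Un_le:
  "hausdorff_measure s (A \<union> B) \<le> hausdorff_measure s A + hausdorff_measure s B"
proof -
  have "hausdorff_measure s (A \<union> B) = hausdorff_measure s (\<Union>n. binaryset A B n)"
    by (simp add: UN_binaryset_eq)
  also have "\<dots> \<le> (\<Sum>n. hausdorff_measure s (binaryset A B n))"
    by (rule hausdorff_measure_UN_le)
  also have "\<dots> = hausdorff_measure s A + hausdorff_measure s B"
    by (rule suminf_binaryset_eq) simp
  finally show ?thesis .
qed

text \<open>
  Every bound on a content is obtained cover by cover; this moves the constant out of the
  infimum. For \<open>c = 0\<close> and \<open>I = {}\<close> the right-hand side would be \<open>0 * top = 0\<close>.
\<close>

lemma ennreal_le_mult_INF: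
  fixes f :: "'a \<Rightarrow> ennreal"
  assumes "0 < c" "c < top" and le: "\<And>i. i \<in> I \<Longrightarrow> x \<le> c * f i"
  shows "x \<le> c * (INF i\<in>I. f i)"
proof -
  have "x / c \<le> (INF i\<in>I. f i)"
    using assms by (intro INF_greatest divide_le_posI_ennreal) auto
  then have "c * (x / c) \<le> c * (INF i\<in>I. f i)"
    by (rule mult_left_mono) simp
  moreover have "c * (x / c) = x"
    using assms by (simp add: ennreal_times_divide mult.commute[of c] ennreal_mult_divide_eq)
  ultimately show ?thesis by simp
qed

lemma hausdorff_content_similarity_image_le:
  fixes g :: "'a::metric_space \<Rightarrow> 'b::real_normed_vector"
  assumes "0 < k" "0 \<le> s" and g: "\<And>x y. dist (g x) (g y) = k * dist x y"
  shows "hausdorff_content s \<delta> (g ` A) \<le> ennreal (k powr s) * hausdorff_content s (\<delta> / k) A"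
proof -
  have bdd: "bounded (g ` X)" and diam: "diameter (g ` X) \<le> k * diameter X"
    if "bounded X" for X
  proof -
    have le: "dist x y \<le> k * diameter X" if "x \<in> g ` X" "y \<in> g ` X" for x y
      using that g diameter_bounded_bound[OF \<open>bounded X\<close>] \<open>0 < k\<close> by auto
    then show "bounded (g ` X)" by (auto simp: bounded_two_points)
    show "diameter (g ` X) \<le> k * diameter X"
      using le diameter_ge_0[OF that] \<open>0 < k\<close> by (intro diameter_le) (auto simp: dist_norm)
  qed
  have pow: "diam_power s (g ` X) \<le> ennreal (k powr s) * diam_power s X" if "bounded X" for X
  proof -
    have "diameter (g ` X) powr s \<le> (k * diameter X) powr s"
      using that bdd diam \<open>0 \<le> s\<close> by (intro powr_mono2) (auto intro: diameter_ge_0)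
    then show ?thesis
      using \<open>0 < k\<close> diameter_ge_0[OF that]
      by (auto simp: diam_power_def powr_mult simp flip: ennreal_mult)
  qed
  have "hausdorff_content s \<delta> (g ` A) \<le> ennreal (k powr s) * (\<Sum>i. diam_power s (U i))"
    if "U \<in> delta_covers (\<delta> / k) A" for U
  proof -
    have U: "A \<subseteq> (\<Union>i. U i)" "bounded (U i)" "diameter (U i) \<le> \<delta> / k" for i
      using that by (auto simp: delta_covers_def)
    have "k * diameter (U i) \<le> \<delta>" for i
      using U(3)[of i] \<open>0 < k\<close> by (simp add: pos_le_divide_eq mult.commute)
    then have "(\<lambda>i. g ` U i) \<in> delta_covers \<delta> (g ` A)"
      using U bdd diam by (fastforce simp: delta_covers_def intro: order_trans)
    then have "hausdorff_content s \<delta> (g ` A) \<le> (\<Sum>i. diam_power s (g ` U i))"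
      unfolding hausdorff_content_def by (rule INF_lower)
    also have "\<dots> \<le> (\<Sum>i. ennreal (k powr s) * diam_power s (U i))"
      by (intro suminf_le pow U) auto
    finally show ?thesis by simp
  qed
  then show ?thesis
    unfolding hausdorff_content_def[of s "\<delta> / k"] using \<open>0 < k\<close>
    by (intro ennreal_le_mult_INF) auto
qed

lemma diam_power_pos: "0 < s \<Longrightarrow> diam_power s A = ennreal (diameter A powr s)"
  by (simp add: diam_power_def)

text \<open>
  A set of diameter at most \<open>\<delta>\<close> satisfies \<open>|X|\<^sup>t \<le> \<delta>\<^sup>t\<^sup>-\<^sup>s |X|\<^sup>s\<close>, and the factor tends to 0.
\<close>

lemma hausdorff_measure_exponent_zero:
  assumes "hausdorff_measure s A < top" "0 < s" "s < t"
  shows "hausdorff_measure t A = 0"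
proof -
  have pow: "diam_power t X \<le> ennreal (\<delta> powr (t - s)) * diam_power s X"
    if "bounded X" "diameter X \<le> \<delta>" for \<delta> and X :: "'a set"
  proof -
    have "diameter X powr t = diameter X powr (t - s) * diameter X powr s"
      by (simp flip: powr_add)
    also have "\<dots> \<le> \<delta> powr (t - s) * diameter X powr s"
      using that assms by (intro mult_right_mono powr_mono2) (auto intro: diameter_ge_0)
    finally show ?thesis
      using assms by (simp add: diam_power_pos flip: ennreal_mult)
  qed
  have content: "hausdorff_content t \<delta> A \<le> ennreal (\<delta> powr (t - s)) * hausdorff_measure s A"
    if "0 < \<delta>" for \<delta>
  proof -
    have "hausdorff_content t \<delta> A \<le> ennreal (\<delta> powr (t - s)) * (\<Sum>i. diam_power s (U i))"
      if "U \<in> delta_covers \<delta> A" for U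
    proof -
      have "hausdorff_content t \<delta> A \<le> (\<Sum>i. diam_power t (U i))"
        unfolding hausdorff_content_def using that by (rule INF_lower)
      also have "\<dots> \<le> (\<Sum>i. ennreal (\<delta> powr (t - s)) * diam_power s (U i))"
        using that by (intro suminf_le pow) (auto simp: delta_covers_def)
      finally show ?thesis by simp
    qed
    then have "hausdorff_content t \<delta> A \<le> ennreal (\<delta> powr (t - s)) * hausdorff_content s \<delta> A"
      unfolding hausdorff_content_def[of s] using \<open>0 < \<delta>\<close>
      by (intro ennreal_le_mult_INF) auto
    also have "\<dots> \<le> ennreal (\<delta> powr (t - s)) * hausdorff_measure s A"
      using that by (intro mult_left_mono hausdorff_content_le_measure) auto
    finally show ?thesis .
  qed
  obtain m where m: "hausdorff_measure s A = ennreal m" "0 \<le> m"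
    using assms(1) by (cases "hausdorff_measure s A") auto
  have "((\<lambda>\<delta>. \<delta> powr (t - s) * m) \<longlongrightarrow> 0 powr (t - s) * m) (at_right (0::real))"
    using assms by (intro tendsto_intros) (auto simp: eventually_at_filter)
  then have lim: "((\<lambda>\<delta>. ennreal (\<delta> powr (t - s) * m)) \<longlongrightarrow> ennreal 0) (at_right (0::real))"
    by (intro tendsto_ennrealI) simp
  have "hausdorff_measure t A \<le> ennreal 0"
    unfolding hausdorff_measure_eq_SUP
  proof (rule tendsto_le[OF _ lim hausdorff_content_tendsto_SUP])
    show "\<forall>\<^sub>F \<delta> in at_right 0. hausdorff_content t \<delta> A \<le> ennreal (\<delta> powr (t - s) * m)"
      using content m by (auto simp: eventually_at_filter ennreal_mult)
  qed simp
  then show ?thesis by simp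
qed

lemma hausdorff_measure_exponent_antimono:
  assumes "0 \<le> t" "t \<le> s" "0 < s"
  shows "hausdorff_measure s A \<le> hausdorff_measure t A"
proof -
  have pow: "diam_power s X \<le> diam_power t X" if "bounded X" "diameter X \<le> 1" for X :: "'a set"
  proof (cases "t = 0")
    case True
    have "diameter X powr s \<le> 1"
      using that assms diameter_ge_0[OF that(1)] by (intro powr_le1) auto
    then show ?thesis using True assms by (simp add: diam_power_def)
  next
    case False
    have "diameter X powr s \<le> diameter X powr t"
      using that assms diameter_ge_0[OF that(1)] by (intro powr_mono') auto
    then show ?thesis using False assms by (simp add: diam_power_def)
  qed
  have content: "hausdorff_content s \<delta> A \<le> hausdorff_content t \<delta> A" if "\<delta> \<le> 1" for \<delta>
    unfolding hausdorff_content_def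
  proof (rule INF_mono)
    fix U assume "U \<in> delta_covers \<delta> A"
    then show "\<exists>V\<in>delta_covers \<delta> A. (\<Sum>i. diam_power s (V i)) \<le> (\<Sum>i. diam_power t (U i))"
      using that by (intro bexI[of _ U] suminf_le pow) (auto simp: delta_covers_def intro: order_trans)
  qed
  show ?thesis
  proof (rule hausdorff_measure_leI)
    fix \<delta> :: real assume "0 < \<delta>"
    have "hausdorff_content s \<delta> A \<le> hausdorff_content s (min \<delta> 1) A"
      by (rule hausdorff_content_antimono) simp
    also have "\<dots> \<le> hausdorff_content t (min \<delta> 1) A" by (rule content) simp
    also have "\<dots> \<le> hausdorff_measure t A"
      using \<open>0 < \<delta>\<close> by (intro hausdorff_content_le_measure) simp
    finally show "hausdorff_content s \<delta> A \<le> hausdorff_measure t A" .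
  qed
qed

lemma hausdorff_dim_eqI:
  fixes A :: "'a::euclidean_space set"
  assumes "0 < s" "0 < hausdorff_measure s A" "hausdorff_measure s A < top"
  shows "hausdorff_dim A = s"
proof -
  have "{t. 0 \<le> t \<and> hausdorff_measure t A = 0} = {s<..}"
    using hausdorff_measure_exponent_zero[OF assms(3,1)]
      hausdorff_measure_exponent_antimono[of _ s A] assms(1,2)
    by (auto simp: not_le[symmetric]) (metis le_zero_eq linorder_not_le)
  then show ?thesis by (simp add: hausdorff_dim_def)
qed

text \<open>
  A set of diameter less than \<open>d\<close> cannot meet both \<open>A\<close> and \<open>B\<close>, so a fine cover of the union
  splits into a cover of \<open>A\<close> and a cover of \<open>B\<close>.
\<close>

lemma hausdorff_measure_separated:
  assumes "0 < d" and sep: "\<And>x y. x \<in> A \<Longrightarrow> y \<in> B \<Longrightarrow> d \<le> dist x y"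
  shows "hausdorff_measure s A + hausdorff_measure s B \<le> hausdorff_measure s (A \<union> B)"
proof -
  have content: "hausdorff_content s \<delta> A + hausdorff_content s \<delta> B \<le> hausdorff_content s \<delta> (A \<union> B)"
    if "0 < \<delta>" "\<delta> < d" for \<delta>
    unfolding hausdorff_content_def[of s \<delta> "A \<union> B"]
  proof (rule INF_greatest)
    fix U assume U: "U \<in> delta_covers \<delta> (A \<union> B)"
    define V where "V X i = (if U i \<inter> X = {} then {} else U i)" for X i
    have "V X \<in> delta_covers \<delta> X" if "X \<subseteq> A \<union> B" for X
      using U that \<open>0 < \<delta>\<close> by (fastforce simp: delta_covers_def V_def)
    then have "hausdorff_content s \<delta> X \<le> (\<Sum>i. diam_power s (V X i))" if "X \<subseteq> A \<union> B" for X
      unfolding hausdorff_content_def using that by (intro INF_lower) auto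
    then have "hausdorff_content s \<delta> A + hausdorff_content s \<delta> B
        \<le> (\<Sum>i. diam_power s (V A i)) + (\<Sum>i. diam_power s (V B i))"
      by (intro add_mono) auto
    also have "\<dots> = (\<Sum>i. diam_power s (V A i) + diam_power s (V B i))"
      by (rule suminf_add) auto
    also have "\<dots> \<le> (\<Sum>i. diam_power s (U i))"
    proof (intro suminf_le)
      fix i
      have "U i \<inter> A = {} \<or> U i \<inter> B = {}"
      proof (rule ccontr)
        assume "\<not> ?thesis"
        then obtain x y where "x \<in> U i" "x \<in> A" "y \<in> U i" "y \<in> B" by auto
        moreover have "bounded (U i)" "diameter (U i) < d"
          using U that by (auto simp: delta_covers_def intro: le_less_trans)
        ultimately show False
          using sep[of x y] diameter_bounded_bound[of "U i" x y] by auto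
      qed
      then show "diam_power s (V A i) + diam_power s (V B i) \<le> diam_power s (U i)"
        by (auto simp: V_def diam_power_def)
    qed auto
    finally show "hausdorff_content s \<delta> A + hausdorff_content s \<delta> B \<le> (\<Sum>i. diam_power s (U i))" .
  qed
  show ?thesis
    unfolding hausdorff_measure_eq_SUP
  proof (rule tendsto_le[OF _ hausdorff_content_tendsto_SUP
        tendsto_add[OF hausdorff_content_tendsto_SUP hausdorff_content_tendsto_SUP]])
    show "\<forall>\<^sub>F \<delta> in at_right 0.
        hausdorff_content s \<delta> A + hausdorff_content s \<delta> B \<le> hausdorff_content s \<delta> (A \<union> B)"
      unfolding eventually_at_right_field using \<open>0 < d\<close> content by blast
  qed simp
qed

lemma hausdorff_measure_UN_separated:
  assumes "\<And>m. 0 < m \<Longrightarrow> 0 < d m"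
    and "\<And>m k x y. k < m \<Longrightarrow> x \<in> R k \<Longrightarrow> y \<in> R m \<Longrightarrow> d m \<le> dist x y"
  shows "(\<Sum>k<m::nat. hausdorff_measure s (R k)) \<le> hausdorff_measure s (\<Union>k<m. R k)"
proof (induction m)
  case (Suc m)
  have "(\<Sum>k<Suc m. hausdorff_measure s (R k))
      \<le> hausdorff_measure s (\<Union>k<m. R k) + hausdorff_measure s (R m)"
    using Suc by (simp add: add_right_mono)
  also have "\<dots> \<le> hausdorff_measure s ((\<Union>k<m. R k) \<union> R m)"
    using assms by (cases "m = 0") (auto intro!: hausdorff_measure_separated[of "d m"])
  also have "(\<Union>k<m. R k) \<union> R m = (\<Union>k<Suc m. R k)"
    by (auto simp: less_Suc_eq)
  finally show ?case .
qed simp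

text \<open>
  Caratheodory's criterion for metric outer measures. The set \<open>X - C\<close> is exhausted by the parts
  \<open>T n\<close> that keep a positive distance from \<open>C\<close>, on which additivity is known. What is missing is a
  union of shells \<open>R k\<close>. Adjacent shells may touch, but shells whose indices have the same parity are
  separated; hence the measures of all shells sum to at most twice the measure of \<open>X\<close>, and the tails
  of this series are negligible.
\<close>

lemma hausdorff_measurable_closed:
  fixes C :: "'a::metric_space set"
  assumes "closed C"
  shows "hausdorff_measurable s C"
proof (cases "C = {}")
  case True
  then show ?thesis by (simp add: hausdorff_measurable_def lambda_system_def)
next
  case False
  have ge: "hausdorff_measure s (C \<inter> X) + hausdorff_measure s (X - C) \<le> hausdorff_measure s X" for X
  proof (cases "hausdorff_measure s X = top")
    case fin: False
    define T where "T k = {x \<in> X. 1 / real (Suc k) \<le> infdist x C}" for k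
    define R where "R k = {x \<in> X. 1 / real (Suc (Suc k)) \<le> infdist x C \<and> infdist x C < 1 / real (Suc k)}" for k
    define f where "f k = hausdorff_measure s (R k)" for k
    have cover: "X - C \<subseteq> T n \<union> (\<Union>k. R (k + n))" for n
    proof
      fix x assume x: "x \<in> X - C"
      then have pos: "0 < infdist x C"
        using False \<open>closed C\<close> by (metis DiffD2 in_closed_iff_infdist_zero infdist_nonneg less_eq_real_def)
      define k where "k = (LEAST k. 1 / real (Suc k) \<le> infdist x C)"
      have "\<exists>k. 1 / real (Suc k) \<le> infdist x C"
        using nat_approx_posE[OF pos] by (meson less_imp_le)
      then have k: "1 / real (Suc k) \<le> infdist x C"
        unfolding k_def by (rule LeastI_ex)
      show "x \<in> T n \<union> (\<Union>k. R (k + n))"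
      proof (cases "k \<le> n")
        case True
        then have "1 / real (Suc n) \<le> 1 / real (Suc k)" by (simp add: field_simps)
        then show ?thesis using k x by (auto simp: T_def)
      next
        case False
        then obtain j where j: "k = Suc (j + n)"
          by (metis add.commute less_imp_Suc_add not_le)
        then have "infdist x C < 1 / real (Suc (j + n))"
          using not_less_Least[of "j + n" "\<lambda>k. 1 / real (Suc k) \<le> infdist x C"] by (simp add: k_def)
        then have "x \<in> R (j + n)" using k x j by (simp add: R_def)
        then show ?thesis by blast
      qed
    qed
    have outer: "hausdorff_measure s (C \<inter> X) + hausdorff_measure s (T n) \<le> hausdorff_measure s X" for n
    proof -
      have "1 / real (Suc n) \<le> dist x y" if "x \<in> C \<inter> X" "y \<in> T n" for x y
        using that infdist_le[of x C y] by (auto simp: T_def dist_commute)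
      then have "hausdorff_measure s (C \<inter> X) + hausdorff_measure s (T n)
          \<le> hausdorff_measure s ((C \<inter> X) \<union> T n)"
        by (intro hausdorff_measure_separated[of "1 / real (Suc n)"]) auto
      also have "\<dots> \<le> hausdorff_measure s X"
        by (rule hausdorff_measure_mono) (auto simp: T_def)
      finally show ?thesis .
    qed
    have alternate: "(\<Sum>j<m. hausdorff_measure s (R (2 * j + b))) \<le> hausdorff_measure s X" for m b
    proof -
      have "(\<Sum>j<m. hausdorff_measure s (R (2 * j + b))) \<le> hausdorff_measure s (\<Union>j<m. R (2 * j + b))"
      proof (rule hausdorff_measure_UN_separated)
        fix m k :: nat and x y assume "k < m" "x \<in> R (2 * k + b)" "y \<in> R (2 * m + b)"
        then have "1 / real (Suc (Suc (2 * k + b))) \<le> infdist x C"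
          "infdist y C < 1 / real (Suc (2 * m + b))"
          by (auto simp: R_def)
        moreover have "1 / real (2 * m + b) \<le> 1 / real (Suc (Suc (2 * k + b)))"
          using \<open>k < m\<close> by (intro divide_left_mono) auto
        moreover have "infdist x C \<le> infdist y C + dist x y"
          by (rule infdist_triangle)
        ultimately show "1 / real (2 * m + b) - 1 / real (Suc (2 * m + b)) \<le> dist x y"
          by linarith
      next
        fix m :: nat assume "0 < m"
        then have "1 / real (Suc (2 * m + b)) < 1 / real (2 * m + b)"
          by (intro divide_strict_left_mono) auto
        then show "0 < 1 / real (2 * m + b) - 1 / real (Suc (2 * m + b))" by simp
      qed
      also have "\<dots> \<le> hausdorff_measure s X"
        by (rule hausdorff_measure_mono) (auto simp: R_def)
      finally show ?thesis .
    qed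
    have "(\<Sum>k<n. f k) \<le> hausdorff_measure s X + hausdorff_measure s X" for n
    proof -
      have "(\<Sum>k<n. f k) \<le> (\<Sum>k<2*n. f k)" by (intro sum_mono2) auto
      also have "\<dots> = (\<Sum>j<n. f (2 * j + 0)) + (\<Sum>j<n. f (2 * j + 1))"
        by (induction n) (auto simp: ac_simps)
      also have "\<dots> \<le> hausdorff_measure s X + hausdorff_measure s X"
        unfolding f_def by (intro add_mono alternate)
      finally show ?thesis .
    qed
    then have "suminf f \<le> hausdorff_measure s X + hausdorff_measure s X"
      by (intro suminf_le_const) auto
    then have f_fin: "suminf f \<noteq> top"
      using fin by (auto simp: top_unique)
    have "(\<Sum>k<n. f k) + (hausdorff_measure s (C \<inter> X) + hausdorff_measure s (X - C))
        \<le> hausdorff_measure s X + suminf f" for n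
    proof -
      have "hausdorff_measure s (X - C) \<le> hausdorff_measure s (T n \<union> (\<Union>k. R (k + n)))"
        using cover by (rule hausdorff_measure_mono)
      also have "\<dots> \<le> hausdorff_measure s (T n) + hausdorff_measure s (\<Union>k. R (k + n))"
        by (rule hausdorff_measure_Un_le)
      also have "\<dots> \<le> hausdorff_measure s (T n) + (\<Sum>k. f (k + n))"
        unfolding f_def by (intro add_left_mono hausdorff_measure_UN_le)
      finally have "(\<Sum>k<n. f k) + (hausdorff_measure s (C \<inter> X) + hausdorff_measure s (X - C))
        \<le> (\<Sum>k<n. f k) + (hausdorff_measure s (C \<inter> X) + (hausdorff_measure s (T n) + (\<Sum>k. f (k + n))))"
        by (intro add_left_mono)
      also have "\<dots> = (hausdorff_measure s (C \<inter> X) + hausdorff_measure s (T n)) + suminf f"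
        by (subst suminf_offset[of f n]) (auto simp: ac_simps)
      also have "\<dots> \<le> hausdorff_measure s X + suminf f"
        using outer by (intro add_right_mono)
      finally show ?thesis .
    qed
    then have "suminf f + (hausdorff_measure s (C \<inter> X) + hausdorff_measure s (X - C))
        \<le> suminf f + hausdorff_measure s X"
      by (subst (2) add.commute) (rule ennreal_suminf_bound_add)
    then show ?thesis
      using f_fin by (simp add: ennreal_add_left_cancel_le)
  qed simp
  show ?thesis
    unfolding hausdorff_measurable_def lambda_system_def
  proof (safe intro!: antisym)
    fix X
    show "hausdorff_measure s (C \<inter> X) + hausdorff_measure s ((UNIV - C) \<inter> X) \<le> hausdorff_measure s X"
      using ge[of X] by (simp add: Int_commute Diff_eq)
    have "hausdorff_measure s X \<le> hausdorff_measure s ((C \<inter> X) \<union> ((UNIV - C) \<inter> X))"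
      by (rule hausdorff_measure_mono) auto
    then show "hausdorff_measure s X \<le> hausdorff_measure s (C \<inter> X) + hausdorff_measure s ((UNIV - C) \<inter> X)"
      using hausdorff_measure_Un_le order_trans by blast
  qed auto
qed

section \<open>Invariant weights on the graph\<close>

context digraph_IFS
begin

text \<open>The matrix with \<open>uv\<close>-entry \<open>\<Sum> r\<^sub>e\<^sup>t\<close>, summed over the edges from \<open>u\<close> to \<open>v\<close>, applied to \<open>h\<close>.\<close>

definition transfer :: "real \<Rightarrow> ('v \<Rightarrow> real) \<Rightarrow> 'v \<Rightarrow> real" where
  "transfer t h u = (\<Sum>e\<in>out_arcs G u. r e powr t * h (head G e))"

lemma verts_nonempty: "verts G \<noteq> {}"
  using strongly_connected by (simp add: strongly_connected_def)

lemma finite_out_arcs [simp]: "finite (out_arcs G u)"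
  by (rule finite_subset[OF _ finite_arcs]) auto

lemma out_arcs_nonempty: "u \<in> verts G \<Longrightarrow> out_arcs G u \<noteq> {}"
  using out_degree_ge_2[of u] by (auto simp: out_degree_def)

lemma head_out_arc [simp]: "e \<in> out_arcs G u \<Longrightarrow> head G e \<in> verts G"
  by auto

lemma out_arc_ratio: "e \<in> out_arcs G u \<Longrightarrow> 0 < r e" "e \<in> out_arcs G u \<Longrightarrow> r e < 1"
  using ratio_pos ratio_less_1 by auto

text \<open>
  All consequences of strong connectivity are drawn through this closure principle.
\<close>

lemma forward_closed_eq_verts:
  assumes "Z \<subseteq> verts G" "Z \<noteq> {}"
    and closed: "\<And>u e. u \<in> Z \<Longrightarrow> e \<in> out_arcs G u \<Longrightarrow> head G e \<in> Z"
  shows "Z = verts G"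
proof -
  obtain u where "u \<in> Z" using assms by auto
  have "v \<in> Z" if "v \<in> verts G" for v
  proof -
    have "u \<rightarrow>\<^sup>*\<^bsub>G\<^esub> v"
      using strongly_connected \<open>u \<in> Z\<close> assms(1) that by (auto simp: strongly_connected_def)
    then show ?thesis
    proof (induction rule: reachable_induct)
      case (step x y)
      then show ?case using closed[of x] by (auto simp: arcs_ends_def arc_to_ends_def)
    qed (use \<open>u \<in> Z\<close> in auto)
  qed
  then show ?thesis using assms(1) by auto
qed

lemma transfer_mono:
  "(\<And>v. v \<in> verts G \<Longrightarrow> g v \<le> h v) \<Longrightarrow> transfer t g u \<le> transfer t h u"
  unfolding transfer_def by (intro sum_mono mult_left_mono) auto

lemma transfer_strict_mono:
  assumes "\<And>v. v \<in> verts G \<Longrightarrow> g v \<le> h v" "e \<in> out_arcs G u" "g (head G e) < h (head G e)"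
  shows "transfer t g u < transfer t h u"
  unfolding transfer_def
proof (rule sum_strict_mono_ex1)
  show "\<exists>e\<in>out_arcs G u. r e powr t * g (head G e) < r e powr t * h (head G e)"
    using assms out_arc_ratio[OF assms(2)] by (intro bexI[of _ e]) auto
qed (use assms in \<open>auto intro!: mult_left_mono\<close>)

lemma transfer_add: "transfer t (\<lambda>v. g v + h v) u = transfer t g u + transfer t h u"
  by (simp add: transfer_def sum.distrib distrib_left)

lemma transfer_cmult: "transfer t (\<lambda>v. c * h v) u = c * transfer t h u"
  by (simp add: transfer_def sum_distrib_left mult.left_commute)

lemma transfer_zero_one: "transfer 0 (\<lambda>_. 1) u = real (out_degree G u)"
proof -
  have "r e powr 0 * 1 = 1" if "e \<in> out_arcs G u" for e
    using out_arc_ratio[OF that] by simp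
  then show ?thesis by (simp add: transfer_def out_degree_def)
qed

definition subinvariant :: "real \<Rightarrow> ('v \<Rightarrow> real) \<Rightarrow> bool" where
  "subinvariant t h \<longleftrightarrow>
     (\<forall>u\<in>verts G. 0 \<le> h u \<and> h u \<le> transfer t h u) \<and> (\<exists>u\<in>verts G. 0 < h u)"

text \<open>
  Finitely many strict inequalities survive a small increase of the exponent.
\<close>

lemma subinvariant_increase_exponent:
  assumes h: "\<And>u. u \<in> verts G \<Longrightarrow> 0 \<le> h u" "\<exists>u\<in>verts G. 0 < h u"
    and strict: "\<And>u. u \<in> verts G \<Longrightarrow> h u < transfer t h u"
  shows "\<exists>t'>t. subinvariant t' h"
proof -
  have "\<forall>\<^sub>F t' in at_right t. h u < transfer t' h u" if "u \<in> verts G" for u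
  proof -
    have "((\<lambda>t'. transfer t' h u) \<longlongrightarrow> transfer t h u) (at_right t)"
      unfolding transfer_def using out_arc_ratio by (intro tendsto_intros) force+
    then show ?thesis using strict[OF that] by (rule order_tendstoD)
  qed
  then have "\<forall>\<^sub>F t' in at_right t. \<forall>u\<in>verts G. h u < transfer t' h u"
    by (intro eventually_ball_finite) auto
  then have "\<forall>\<^sub>F t' in at_right t. t < t' \<and> (\<forall>u\<in>verts G. h u < transfer t' h u)"
    using eventually_at_right_less[of t] by eventually_elim auto
  then obtain t' where "t < t'" "\<forall>u\<in>verts G. h u < transfer t' h u"
    using eventually_happens'[of "at_right t"] by auto
  then show ?thesis
    using h by (auto simp: subinvariant_def intro!: exI[of _ t'] less_imp_le)
qed

text \<open>
  Strictness at one vertex can be spread to all vertices: adding \<open>transfer t g\<close> to \<open>g\<close> keeps every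
  strict inequality and creates a new one at any vertex with an edge into the strict region. Instead of
  iterating this, choose \<open>g\<close> with the fewest tight vertices; strong connectivity then leaves
  none.
\<close>

lemma subinvariant_somewhere_strict:
  assumes "subinvariant t h" "u \<in> verts G" "h u < transfer t h u"
  shows "\<exists>t'>t. \<exists>g. subinvariant t' g"
proof -
  define tight where "tight g = {u \<in> verts G. g u = transfer t g u}" for g
  define P where "P g \<longleftrightarrow> subinvariant t g \<and> tight g \<noteq> verts G" for g
  have "u \<notin> tight h" using assms by (simp add: tight_def)
  then have "P h" using assms by (auto simp: P_def)
  then obtain g where "P g" and least: "\<And>g'. P g' \<Longrightarrow> card (tight g) \<le> card (tight g')"
    using ex_has_least_nat[of P h "\<lambda>g. card (tight g)"] by auto
  then have g: "subinvariant t g" and ne: "tight g \<noteq> verts G" by (auto simp: P_def)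
  have "tight g = {}"
  proof (rule ccontr)
    assume "tight g \<noteq> {}"
    then obtain u e where u: "u \<in> tight g" and e: "e \<in> out_arcs G u" "head G e \<notin> tight g"
      using forward_closed_eq_verts[of "tight g"] ne by (auto simp: tight_def)
    define g' where "g' v = g v + transfer t g v" for v
    have g'_eq: "transfer t g' v = transfer t g v + transfer t (transfer t g) v" for v
      by (simp add: g'_def[abs_def] transfer_add)
    have le: "g v \<le> transfer t g v" if "v \<in> verts G" for v
      using g that by (auto simp: subinvariant_def)
    have mono: "transfer t g v \<le> transfer t (transfer t g) v" for v
      by (rule transfer_mono) (rule le)
    have "subinvariant t g'"
      using g le mono unfolding subinvariant_def g'_eq unfolding g'_def
      by (smt (verit, best))
    have less: "g (head G e) < transfer t g (head G e)"
      using e le[of "head G e"] by (auto simp: tight_def less_le)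
    have strict_u: "transfer t g u < transfer t (transfer t g) u"
      using le e(1) less by (rule transfer_strict_mono)
    have "tight g' \<subseteq> tight g - {u}"
    proof
      fix v assume "v \<in> tight g'"
      then have v: "v \<in> verts G" "g v + transfer t g v = transfer t g v + transfer t (transfer t g) v"
        by (auto simp: tight_def g'_eq) (simp add: g'_def)
      then have "transfer t (transfer t g) v = g v" by simp
      then have "g v = transfer t g v" "v \<noteq> u"
        using le[OF v(1)] mono[of v] strict_u by auto
      then show "v \<in> tight g - {u}" using v(1) by (simp add: tight_def)
    qed
    then have "card (tight g') < card (tight g)"
      using u by (intro psubset_card_mono) (auto simp: tight_def)
    moreover have "tight g' \<noteq> verts G"
      using \<open>tight g' \<subseteq> tight g - {u}\<close> u by (auto simp: tight_def)
    ultimately show False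
      using least[of g'] \<open>subinvariant t g'\<close> by (auto simp: P_def)
  qed
  then have "\<exists>t'>t. subinvariant t' g"
    using g by (intro subinvariant_increase_exponent)
      (auto simp: subinvariant_def tight_def less_le)
  then show ?thesis by auto
qed

lemma invariant_weights_pos:
  assumes "\<And>u. u \<in> verts G \<Longrightarrow> 0 \<le> h u" and inv: "\<And>u. u \<in> verts G \<Longrightarrow> h u = transfer t h u"
    and "\<exists>u\<in>verts G. 0 < h u" "u \<in> verts G"
  shows "0 < h u"
proof (rule ccontr)
  assume "\<not> 0 < h u"
  define Z where "Z = {u \<in> verts G. h u = 0}"
  have "Z = verts G"
  proof (rule forward_closed_eq_verts)
    show "Z \<noteq> {}" using assms(1)[of u] \<open>\<not> 0 < h u\<close> \<open>u \<in> verts G\<close> by (force simp: Z_def)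
    fix v e assume "v \<in> Z" and e: "e \<in> out_arcs G v"
    then have "(\<Sum>e\<in>out_arcs G v. r e powr t * h (head G e)) = 0"
      using inv[of v] by (auto simp: Z_def transfer_def)
    then have "r e powr t * h (head G e) = 0"
      using e assms(1) by (subst (asm) sum_nonneg_eq_0_iff) auto
    then show "head G e \<in> Z" using e out_arc_ratio[OF e] by (auto simp: Z_def)
  qed (auto simp: Z_def)
  then have "\<forall>u\<in>verts G. h u = 0" by (auto simp: Z_def)
  then show False using assms(3) by auto
qed

text \<open>
  A maximum principle: where the ratio \<open>c / h\<close> is maximal, subinvariance forces it to be maximal at
  all successors too, and so everywhere.
\<close>

lemma subinvariant_proportional:
  assumes pos: "\<And>u. u \<in> verts G \<Longrightarrow> 0 < h u" and inv: "\<And>u. u \<in> verts G \<Longrightarrow> h u = transfer t h u"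
    and sub: "\<And>u. u \<in> verts G \<Longrightarrow> c u \<le> transfer t c u"
  shows "\<exists>\<theta>. \<forall>u\<in>verts G. c u = \<theta> * h u"
proof -
  define \<theta> where "\<theta> = Max ((\<lambda>u. c u / h u) ` verts G)"
  have le: "c u \<le> \<theta> * h u" if "u \<in> verts G" for u
  proof -
    have "c u / h u \<le> \<theta>" unfolding \<theta>_def using that by (intro Max_ge) auto
    then show ?thesis using pos[OF that] by (simp add: divide_le_eq)
  qed
  define Z where "Z = {u \<in> verts G. c u = \<theta> * h u}"
  have "Z = verts G"
  proof (rule forward_closed_eq_verts)
    have "\<theta> \<in> (\<lambda>u. c u / h u) ` verts G"
      unfolding \<theta>_def using verts_nonempty by (intro Max_in) auto
    then obtain u where "u \<in> verts G" "\<theta> = c u / h u" by auto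
    then have "u \<in> Z" using pos[of u] by (simp add: Z_def)
    then show "Z \<noteq> {}" by auto
    fix u e assume u: "u \<in> Z" and e: "e \<in> out_arcs G u"
    show "head G e \<in> Z"
    proof (rule ccontr)
      assume "head G e \<notin> Z"
      then have "c (head G e) < \<theta> * h (head G e)"
        using e le[of "head G e"] by (auto simp: Z_def)
      then have "transfer t c u < transfer t (\<lambda>v. \<theta> * h v) u"
        using le e by (intro transfer_strict_mono)
      then show False
        using u sub[of u] inv[of u] by (auto simp: Z_def transfer_cmult)
    qed
  qed (auto simp: Z_def)
  then show ?thesis by (auto simp: Z_def)
qed

text \<open>
  At a vertex where \<open>h\<close> is maximal, subinvariance implies that the sum of all \<open>r e powr t\<close> is at
  least 1, which fails for large \<open>t\<close>.
\<close>

lemma subinvariant_exponent_bounded: "\<exists>T. \<forall>t h. subinvariant t h \<longrightarrow> t < T"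
proof -
  have "(\<lambda>n. \<Sum>e\<in>arcs G. r e ^ n) \<longlonglongrightarrow> (\<Sum>e\<in>arcs G. 0)"
    using ratio_pos ratio_less_1 by (intro tendsto_sum LIMSEQ_realpow_zero less_imp_le) auto
  then have "\<forall>\<^sub>F n in sequentially. (\<Sum>e\<in>arcs G. r e ^ n) < 1"
    by (intro order_tendstoD(2)) auto
  then obtain n where n: "(\<Sum>e\<in>arcs G. r e ^ n) < 1"
    using eventually_happens'[of sequentially] by auto
  define T where "T = real n"
  have T: "(\<Sum>e\<in>arcs G. r e powr T) < 1"
    using n ratio_pos by (simp add: T_def powr_realpow cong: sum.cong)
  have "t < T" if "subinvariant t h" for t h
  proof (rule ccontr)
    assume "\<not> t < T"
    have h: "\<And>u. u \<in> verts G \<Longrightarrow> 0 \<le> h u" "\<And>u. u \<in> verts G \<Longrightarrow> h u \<le> transfer t h u"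
      and ex: "\<exists>u\<in>verts G. 0 < h u" using that by (auto simp: subinvariant_def)
    obtain u where u: "u \<in> verts G" and max: "\<And>v. v \<in> verts G \<Longrightarrow> h v \<le> h u"
    proof -
      have "Max (h ` verts G) \<in> h ` verts G" using verts_nonempty by (intro Max_in) auto
      then obtain u where "u \<in> verts G" "h u = Max (h ` verts G)" by auto
      then show ?thesis using that[of u] by simp
    qed
    then have "0 < h u" using ex by force
    have "h u \<le> transfer t h u" using h(2) u by simp
    also have "\<dots> \<le> (\<Sum>e\<in>out_arcs G u. r e powr t * h u)"
      unfolding transfer_def by (intro sum_mono mult_left_mono max) auto
    also have "\<dots> = (\<Sum>e\<in>out_arcs G u. r e powr t) * h u"
      by (simp add: sum_distrib_right)
    also have "\<dots> \<le> (\<Sum>e\<in>arcs G. r e powr t) * h u"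
      using \<open>0 < h u\<close> by (intro mult_right_mono sum_mono2) auto
    also have "\<dots> \<le> (\<Sum>e\<in>arcs G. r e powr T) * h u"
      using \<open>0 < h u\<close> \<open>\<not> t < T\<close> ratio_pos ratio_less_1
      by (intro mult_right_mono sum_mono powr_mono') (auto intro: less_imp_le)
    also have "\<dots> < 1 * h u" using T \<open>0 < h u\<close> by (rule mult_strict_right_mono)
    finally show False by simp
  qed
  then show ?thesis by auto
qed

text \<open>
  After normalising the sum of the weights to 1, the admissible pairs \<open>(t, h)\<close> with \<open>t \<ge> 0\<close> form a
  compact set, on which the exponent attains its maximum.
\<close>

lemma ex_max_subinvariant_exponent:
  "\<exists>s h. 0 \<le> s \<and> subinvariant s h \<and> (\<forall>t g. subinvariant t g \<longrightarrow> t \<le> s)"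
proof -
  obtain T where T: "\<And>t h. subinvariant t h \<Longrightarrow> t < T"
    using subinvariant_exponent_bounded by auto
  define B :: "('v \<Rightarrow> real) set" where "B = PiE UNIV (\<lambda>u. if u \<in> verts G then {0..1} else {0})"
  define K where "K = {p \<in> {0..T} \<times> B. (\<Sum>u\<in>verts G. snd p u) = 1
      \<and> (\<forall>u\<in>verts G. snd p u \<le> transfer (fst p) (snd p) u)}"
  have "compact B"
  proof -
    have "compact (PiE UNIV S) \<longleftrightarrow> PiE UNIV S = {} \<or> (\<forall>i. compact (S i))"
      for S :: "'v \<Rightarrow> real set"
      using compactin_PiE[of "\<lambda>_. euclidean" UNIV S] by (simp add: euclidean_product_topology)
    then show ?thesis unfolding B_def by auto
  qed
  have normalise: "(t, \<lambda>u. if u \<in> verts G then h u / sum h (verts G) else 0) \<in> K"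
    if "subinvariant t h" "0 \<le> t" for t h
  proof -
    define \<sigma> where "\<sigma> = sum h (verts G)"
    \<comment> \<open>Weights off the graph are set to 0, which keeps the function space compact.\<close>
    define g where "g u = (if u \<in> verts G then h u / \<sigma> else 0)" for u
    have h: "\<And>u. u \<in> verts G \<Longrightarrow> 0 \<le> h u" "\<And>u. u \<in> verts G \<Longrightarrow> h u \<le> transfer t h u"
      and "\<exists>u\<in>verts G. 0 < h u" using that by (auto simp: subinvariant_def)
    then have "0 < \<sigma>" unfolding \<sigma>_def by (auto intro: sum_pos2)
    have le: "h u \<le> \<sigma>" if "u \<in> verts G" for u
      unfolding \<sigma>_def using h that by (intro member_le_sum) auto
    have "transfer t g u = transfer t h u / \<sigma>" for u
      unfolding transfer_def sum_divide_distrib g_def by (intro sum.cong) auto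
    then have "\<forall>u\<in>verts G. g u \<le> transfer t g u"
      using h(2) \<open>0 < \<sigma>\<close> by (auto simp: g_def divide_right_mono)
    moreover have "sum g (verts G) = 1"
      using \<open>0 < \<sigma>\<close> by (simp add: g_def \<sigma>_def flip: sum_divide_distrib)
    moreover have "g \<in> B"
      using h le \<open>0 < \<sigma>\<close> by (auto simp: B_def g_def divide_le_eq)
    ultimately show ?thesis
      using T[OF that(1)] that(2) unfolding K_def g_def \<sigma>_def by auto
  qed
  have [continuous_intros]: "continuous_on A (\<lambda>p. snd p u)" for u :: 'v and A :: "(real \<times> ('v \<Rightarrow> real)) set"
    by (rule continuous_on_product_then_coordinatewise) (intro continuous_intros)
  have "compact K"
  proof -
    have "closed {p :: real \<times> ('v \<Rightarrow> real). (\<Sum>u\<in>verts G. snd p u) = 1}"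
      by (intro closed_Collect_eq continuous_intros)
    moreover have "closed {p. snd p u \<le> transfer (fst p) (snd p) u}" for u
      unfolding transfer_def using out_arc_ratio
      by (intro closed_Collect_le continuous_intros) force+
    ultimately have "closed ({p. (\<Sum>u\<in>verts G. snd p u) = 1}
        \<inter> (\<Inter>u\<in>verts G. {p. snd p u \<le> transfer (fst p) (snd p) u}))"
      by (intro closed_Int closed_INT) auto
    then have "compact (({0..T} \<times> B) \<inter> ({p. (\<Sum>u\<in>verts G. snd p u) = 1}
        \<inter> (\<Inter>u\<in>verts G. {p. snd p u \<le> transfer (fst p) (snd p) u})))"
      using \<open>compact B\<close> by (intro compact_Int_closed compact_Times) auto
    also have "({0..T} \<times> B) \<inter> ({p. (\<Sum>u\<in>verts G. snd p u) = 1}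
        \<inter> (\<Inter>u\<in>verts G. {p. snd p u \<le> transfer (fst p) (snd p) u})) = K"
      by (auto simp: K_def)
    finally show ?thesis .
  qed
  have "subinvariant 0 (\<lambda>_. 1)"
    using out_degree_ge_2 verts_nonempty by (fastforce simp: subinvariant_def transfer_zero_one)
  from normalise[OF this] have "K \<noteq> {}" by auto
  moreover have "continuous_on K fst" by (intro continuous_intros)
  ultimately obtain p where "p \<in> K" and max: "\<And>q. q \<in> K \<Longrightarrow> fst q \<le> fst p"
    using continuous_attains_sup[OF \<open>compact K\<close>, of fst] by blast
  have "subinvariant (fst p) (snd p)"
  proof -
    have nonneg: "\<forall>u\<in>verts G. 0 \<le> snd p u"
    proof
      fix u assume "u \<in> verts G"
      moreover have "snd p u \<in> (if u \<in> verts G then {0..1} else {0})"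
        using \<open>p \<in> K\<close> unfolding K_def B_def by (intro PiE_mem[of "snd p" UNIV]) auto
      ultimately show "0 \<le> snd p u" by simp
    qed
    have "\<exists>u\<in>verts G. 0 < snd p u"
    proof (rule ccontr)
      assume "\<not> ?thesis"
      then have "(\<Sum>u\<in>verts G. snd p u) \<le> 0" by (intro sum_nonpos) auto
      then show False using \<open>p \<in> K\<close> by (auto simp: K_def)
    qed
    then show ?thesis using nonneg \<open>p \<in> K\<close> by (auto simp: subinvariant_def K_def)
  qed
  moreover have "t \<le> fst p" if "subinvariant t g" for t g
  proof (cases "0 \<le> t")
    case True
    then show ?thesis using max[OF normalise[OF that]] by simp
  next
    case False
    then show ?thesis using \<open>p \<in> K\<close> by (auto simp: K_def)
  qed
  moreover have "0 \<le> fst p" using \<open>p \<in> K\<close> by (auto simp: K_def)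
  ultimately show ?thesis by blast
qed

text \<open>
  The existence part of Perron-Frobenius theory: \<open>s\<close> is the exponent at which the matrix with entries
  \<open>\<Sum> r\<^sub>e\<^sup>s\<close> has spectral radius 1, and \<open>h\<close> is its Perron eigenvector. That \<open>s\<close> is positive is due to
  the two edges leaving each vertex, which make the constant weights strictly subinvariant at exponent
  0.
\<close>

lemma ex_invariant_weights:
  "\<exists>s h. 0 < s \<and> (\<forall>u\<in>verts G. 0 < h u \<and> h u = transfer s h u)"
proof -
  obtain s h where "0 \<le> s" and h: "subinvariant s h"
    and max: "\<And>t g. subinvariant t g \<Longrightarrow> t \<le> s"
    using ex_max_subinvariant_exponent by blast
  have inv: "h u = transfer s h u" if "u \<in> verts G" for u
    using subinvariant_somewhere_strict[OF h that] max h that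
    by (fastforce simp: subinvariant_def less_le)
  then have "\<forall>u\<in>verts G. 0 < h u \<and> h u = transfer s h u"
    using h invariant_weights_pos[of h s] by (auto simp: subinvariant_def)
  moreover have "0 < s"
  proof -
    have "1 < transfer 0 (\<lambda>_. 1) u" if "u \<in> verts G" for u
      using out_degree_ge_2[OF that] by (simp add: transfer_zero_one)
    then obtain t where "0 < t" "subinvariant t (\<lambda>_. 1)"
      using subinvariant_increase_exponent[of "\<lambda>_. 1" 0] verts_nonempty by auto
    then show ?thesis using max by fastforce
  qed
  ultimately show ?thesis by blast
qed

end

section \<open>Similarities and volume\<close>

text \<open>
  Up to scaling and translation a similarity is an isometry that fixes the origin, hence linear and
  orthogonal, and such maps are onto in finite dimension.
\<close>

lemma similarity_surj:
  fixes g :: "'a::euclidean_space \<Rightarrow> 'a"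
  assumes "0 < k" and g: "\<And>x y. dist (g x) (g y) = k * dist x y"
  shows "surj g"
proof -
  define f where "f x = (g x - g 0) /\<^sub>R k" for x
  have "dist (f x) (f y) = dist x y" for x y
  proof -
    have "f x - f y = (g x - g y) /\<^sub>R k" by (simp add: f_def algebra_simps)
    then have "dist (f x) (f y) = dist (g x) (g y) / k"
      using \<open>0 < k\<close> by (simp only: dist_norm norm_scaleR) (simp add: divide_inverse)
    then show ?thesis using g \<open>0 < k\<close> by simp
  qed
  then have "orthogonal_transformation f"
    by (simp add: orthogonal_transformation_isometry f_def)
  then have "surj f" by (rule orthogonal_transformation_surj)
  have "\<exists>x. y = g x" for y
  proof -
    obtain x where "f x = (y - g 0) /\<^sub>R k" using surjD[OF \<open>surj f\<close>] by metis
    then show ?thesis using \<open>0 < k\<close> by (auto simp: f_def)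
  qed
  then show ?thesis by auto
qed

lemma similarity_image_ball:
  fixes g :: "'a::euclidean_space \<Rightarrow> 'a"
  assumes "0 < k" and g: "\<And>x y. dist (g x) (g y) = k * dist x y"
  shows "g ` ball x \<rho> = ball (g x) (k * \<rho>)"
proof
  show "g ` ball x \<rho> \<subseteq> ball (g x) (k * \<rho>)" using \<open>0 < k\<close> by (auto simp: g)
  show "ball (g x) (k * \<rho>) \<subseteq> g ` ball x \<rho>"
  proof
    fix y assume y: "y \<in> ball (g x) (k * \<rho>)"
    obtain z where "y = g z" using surjD[OF similarity_surj[OF assms]] by metis
    then show "y \<in> g ` ball x \<rho>" using y \<open>0 < k\<close> by (auto simp: g)
  qed
qed

lemma similarity_vimage_ball:
  assumes "0 < k" and g: "\<And>x y. dist (g x) (g y) = k * dist x y"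
  shows "g -` ball (g y) \<rho> = ball y (\<rho> / k)"
  using \<open>0 < k\<close> by (auto simp: g less_divide_eq mult.commute)

lemma similarity_open_image:
  fixes g :: "'a::euclidean_space \<Rightarrow> 'a"
  assumes "0 < k" and g: "\<And>x y. dist (g x) (g y) = k * dist x y" and "open W"
  shows "open (g ` W)"
  unfolding open_contains_ball
proof
  fix y assume "y \<in> g ` W"
  then obtain x where "x \<in> W" "y = g x" by auto
  then obtain \<rho> where "0 < \<rho>" "ball x \<rho> \<subseteq> W" using \<open>open W\<close> by (auto simp: open_contains_ball)
  then have "ball y (k * \<rho>) \<subseteq> g ` W"
    using similarity_image_ball[OF assms(1) g, of x \<rho>] \<open>y = g x\<close> by blast
  then show "\<exists>\<epsilon>>0. ball y \<epsilon> \<subseteq> g ` W" using \<open>0 < \<rho>\<close> \<open>0 < k\<close> by (auto intro!: exI[of _ "k * \<rho>"])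
qed

text \<open>
  By Vitali's covering theorem an open set is, up to a null set, a disjoint union of balls, and
  the images of these balls are disjoint balls with radii scaled by \<open>k\<close>.
\<close>

lemma emeasure_similarity_open_image_ge:
  fixes g :: "'a::euclidean_space \<Rightarrow> 'a"
  assumes "0 < k" and g: "\<And>x y. dist (g x) (g y) = k * dist x y" and "open W"
  shows "ennreal (k ^ DIM('a)) * emeasure lborel W \<le> emeasure lborel (g ` W)"
proof -
  define K where "K = {p. 0 < snd p \<and> ball (fst p) (snd p) \<subseteq> W}"
  define B where "B p = ball (fst p) (snd p)" for p :: "'a \<times> real"
  have "\<exists>i. i \<in> K \<and> x \<in> ball (fst i) (snd i) \<and> snd i < d" if "x \<in> W" "0 < d" for x d
  proof -
    obtain \<rho> where "0 < \<rho>" "ball x \<rho> \<subseteq> W"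
      using \<open>open W\<close> \<open>x \<in> W\<close> by (auto simp: open_contains_ball)
    then show ?thesis
      using \<open>0 < d\<close> by (intro exI[of _ "(x, min \<rho> (d / 2))"]) (auto simp: K_def)
  qed
  then obtain C where C: "countable C" "C \<subseteq> K"
    and disj: "pairwise (\<lambda>i j. disjnt (B i) (B j)) C"
    and null: "negligible (W - (\<Union>i\<in>C. B i))"
    unfolding B_def by (rule Vitali_covering_theorem_balls)
  have fam: "disjoint_family_on B C"
    using disj by (auto simp: pairwise_def disjoint_family_on_def disjnt_def)
  have "inj g" using \<open>0 < k\<close> g by (auto intro!: injI) (metis dist_eq_0_iff mult_eq_0_iff less_irrefl)
  then have fam': "disjoint_family_on (\<lambda>i. g ` B i) C"
    using fam by (simp add: disjoint_family_on_def flip: image_Int[OF \<open>inj g\<close>])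
  have [measurable]: "B i \<in> sets borel" "g ` B i \<in> sets borel" for i
    using similarity_open_image[OF assms(1) g] by (auto simp: B_def)
  have W: "W \<in> sets borel" using \<open>open W\<close> by auto
  have "open (\<Union>i\<in>C. B i)" by (auto simp: B_def)
  then have UB: "(\<Union>i\<in>C. B i) \<in> sets borel" by simp
  then have diff: "W - (\<Union>i\<in>C. B i) \<in> sets lborel" using W by (simp add: sets.Diff)
  have null': "W - (\<Union>i\<in>C. B i) \<in> null_sets lborel"
    using null null_sets_completion_iff[OF diff] by (simp only: negligible_iff_null_sets)
  have "emeasure lborel W \<le> emeasure lborel ((\<Union>i\<in>C. B i) \<union> (W - (\<Union>i\<in>C. B i)))"
    using UB W by (intro emeasure_mono) auto
  also have "\<dots> = emeasure lborel (\<Union>i\<in>C. B i)"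
    using UB by (intro emeasure_Un_null_set null') auto
  also have "\<dots> = (\<integral>\<^sup>+i. emeasure lborel (B i) \<partial>count_space C)"
    using C(1) fam by (intro emeasure_UN_countable) auto
  finally have "ennreal (k ^ DIM('a)) * emeasure lborel W
      \<le> ennreal (k ^ DIM('a)) * (\<integral>\<^sup>+i. emeasure lborel (B i) \<partial>count_space C)"
    by (intro mult_left_mono) auto
  also have "\<dots> = (\<integral>\<^sup>+i. ennreal (k ^ DIM('a)) * emeasure lborel (B i) \<partial>count_space C)"
    by (rule nn_integral_cmult[symmetric]) auto
  also have "\<dots> = (\<integral>\<^sup>+i. emeasure lborel (g ` B i) \<partial>count_space C)"
  proof (intro nn_integral_cong)
    fix i assume "i \<in> space (count_space C)"
    then have "0 < snd i" using C(2) by (auto simp: K_def)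
    then show "ennreal (k ^ DIM('a)) * emeasure lborel (B i) = emeasure lborel (g ` B i)"
      using \<open>0 < k\<close> by (simp add: B_def similarity_image_ball[OF assms(1) g] emeasure_ball
          power_mult_distrib mult_ac flip: ennreal_mult)
  qed
  also have "\<dots> = emeasure lborel (\<Union>i\<in>C. g ` B i)"
    using C(1) fam' by (intro emeasure_UN_countable[symmetric]) auto
  also have "\<dots> \<le> emeasure lborel (g ` W)"
    using C(2) similarity_open_image[OF assms] by (intro emeasure_mono) (auto simp: K_def B_def)
  finally show ?thesis .
qed

lemma similarity_bounded_image:
  fixes g :: "'a::metric_space \<Rightarrow> 'b::metric_space"
  assumes g: "\<And>x y. dist (g x) (g y) = k * dist x y" and "bounded W" "0 < k"
  shows "bounded (g ` W)"
proof -
  obtain b where "\<And>x y. x \<in> W \<Longrightarrow> y \<in> W \<Longrightarrow> dist x y \<le> b"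
    using \<open>bounded W\<close> by (auto simp: bounded_two_points)
  then show ?thesis
    using \<open>0 < k\<close> by (auto simp: bounded_two_points g intro!: exI[of _ "k * b"])
qed

lemma measure_similarity_open_image_ge:
  fixes g :: "'a::euclidean_space \<Rightarrow> 'a"
  assumes "0 < k" and g: "\<And>x y. dist (g x) (g y) = k * dist x y" and "open W" "bounded W"
  shows "k ^ DIM('a) * measure lborel W \<le> measure lborel (g ` W)"
proof -
  have "emeasure lborel W < \<infinity>" "emeasure lborel (g ` W) < \<infinity>"
    by (intro emeasure_bounded_finite similarity_bounded_image[OF g] assms)+
  then have "ennreal (k ^ DIM('a) * measure lborel W) \<le> ennreal (measure lborel (g ` W))"
    using emeasure_similarity_open_image_ge[OF assms(1-3)] \<open>0 < k\<close>
    by (simp add: ennreal_mult emeasure_eq_ennreal_measure)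
  then show ?thesis by (simp add: ennreal_le_iff)
qed

section \<open>Positivity under the open set condition\<close>

context digraph_IFS
begin

lemma out_arc_similarity:
  assumes "e \<in> out_arcs G u"
  shows "dist (S e x) (S e y) = r e * dist x y" "0 < r e"
  using assms similarity ratio_pos by auto

lemma ratio_bounds:
  obtains m M where "0 < m" "m \<le> 1" "0 < M" "M < 1"
    "\<And>e. e \<in> arcs G \<Longrightarrow> m \<le> r e" "\<And>e. e \<in> arcs G \<Longrightarrow> r e \<le> M"
proof
  have ne: "arcs G \<noteq> {}"
    using verts_nonempty out_arcs_nonempty by fastforce
  show "0 < Min (r ` arcs G)" using ne ratio_pos by (subst Min_gr_iff) auto
  show "Max (r ` arcs G) < 1" using ne ratio_less_1 by (subst Max_less_iff) auto
  obtain e where "e \<in> arcs G" using ne by auto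
  then have "Min (r ` arcs G) \<le> r e" "r e \<le> Max (r ` arcs G)" by auto
  then show "Min (r ` arcs G) \<le> 1" "0 < Max (r ` arcs G)"
    using ratio_pos[OF \<open>e \<in> arcs G\<close>] ratio_less_1[OF \<open>e \<in> arcs G\<close>] by linarith+
qed auto

end

text \<open>
  The witnesses \<open>U\<close> of the open set condition are parameters, so that one choice of them
  serves all lemmas below.
\<close>

locale osc_IFS = digraph_IFS G S r
  for G :: "('v, 'e) pre_digraph" and S :: "'e \<Rightarrow> real ^ 'n \<Rightarrow> real ^ 'n" and r +
  fixes F U :: "'v \<Rightarrow> (real ^ 'n) set"
  assumes attractor: "is_attractor G S F"
    and U_ne: "u \<in> verts G \<Longrightarrow> U u \<noteq> {}"
    and U_bounded: "u \<in> verts G \<Longrightarrow> bounded (U u)"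
    and U_open: "u \<in> verts G \<Longrightarrow> open (U u)"
    and U_sub: "u \<in> verts G \<Longrightarrow> e \<in> out_arcs G u \<Longrightarrow> S e ` U (head G e) \<subseteq> U u"
    and U_disjoint: "u \<in> verts G \<Longrightarrow> e \<in> out_arcs G u \<Longrightarrow> f \<in> out_arcs G u \<Longrightarrow> e \<noteq> f \<Longrightarrow>
           S e ` U (head G e) \<inter> S f ` U (head G f) = {}"
begin

lemma F_ne: "u \<in> verts G \<Longrightarrow> F u \<noteq> {}"
  and F_compact: "u \<in> verts G \<Longrightarrow> compact (F u)"
  and F_eq: "u \<in> verts G \<Longrightarrow> F u = (\<Union>e\<in>out_arcs G u. S e ` F (head G e))"
  using attractor unfolding is_attractor_def by blast+

lemma F_bounded: "u \<in> verts G \<Longrightarrow> bounded (F u)"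
  using F_compact by (rule compact_imp_bounded)

lemma fmeasurable_U_Int: "u \<in> verts G \<Longrightarrow> open W \<Longrightarrow> U u \<inter> W \<in> fmeasurable lborel"
  using U_open[of u] U_bounded[of u]
  by (intro fmeasurableI emeasure_bounded_finite) (auto simp: open_Int bounded_Int)

lemma measure_U_pos:
  assumes u: "u \<in> verts G"
  shows "0 < measure lborel (U u)"
proof -
  obtain x where "x \<in> U u" using U_ne[OF u] by auto
  then obtain \<rho> where "0 < \<rho>" "ball x \<rho> \<subseteq> U u"
    using U_open[OF u] by (meson open_contains_ball)
  then have "measure lborel (ball x \<rho>) \<le> measure lborel (U u)"
    using fmeasurable_U_Int[OF u open_UNIV] by (intro measure_mono_fmeasurable) auto
  then show ?thesis using content_ball_pos[OF \<open>0 < \<rho>\<close>, of x] by linarith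
qed

text \<open>
  The sets \<open>S e ` U (head G e)\<close> compete for the volume of \<open>U u\<close> inside the ball; this is where the
  disjointness in the open set condition enters.
\<close>

lemma measure_pieces_le:
  assumes "u \<in> verts G"
  shows "(\<Sum>e\<in>out_arcs G u. r e ^ CARD('n) * measure lborel (U (head G e) \<inter> S e -` ball x \<rho>))
    \<le> measure lborel (U u \<inter> ball x \<rho>)"
proof -
  define W where "W e = U (head G e) \<inter> S e -` ball x \<rho>" for e
  have W: "open (W e)" "bounded (W e)" if e: "e \<in> out_arcs G u" for e
  proof -
    obtain y where "x = S e y"
      using surjD[OF similarity_surj[OF out_arc_similarity(2,1)[OF e]]] by metis
    then have "W e = U (head G e) \<inter> ball y (\<rho> / r e)"
      unfolding W_def using similarity_vimage_ball[OF out_arc_similarity(2,1)[OF e]] by simp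
    then show "open (W e)" "bounded (W e)"
      using e U_open[of "head G e"] U_bounded[of "head G e"] by (auto simp: bounded_Int)
  qed
  have sub: "(\<Union>e\<in>out_arcs G u. S e ` W e) \<subseteq> U u \<inter> ball x \<rho>"
    using U_sub[OF assms] by (fastforce simp: W_def)
  have open_image: "open (S e ` W e)" if "e \<in> out_arcs G u" for e
    by (rule similarity_open_image[OF out_arc_similarity(2,1) W(1)]) (use that in auto)
  have "(\<Sum>e\<in>out_arcs G u. r e ^ CARD('n) * measure lborel (W e))
      \<le> (\<Sum>e\<in>out_arcs G u. measure lborel (S e ` W e))"
  proof (rule sum_mono)
    fix e assume "e \<in> out_arcs G u"
    then show "r e ^ CARD('n) * measure lborel (W e) \<le> measure lborel (S e ` W e)"
      using measure_similarity_open_image_ge[OF out_arc_similarity(2,1) W] by simp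
  qed
  also have "\<dots> = measure lborel (\<Union>e\<in>out_arcs G u. S e ` W e)"
  proof (rule measure_finite_Union[symmetric])
    show "(\<lambda>e. S e ` W e) ` out_arcs G u \<subseteq> sets lborel"
      using open_image by auto
    show "disjoint_family_on (\<lambda>e. S e ` W e) (out_arcs G u)"
      using U_disjoint[OF assms] by (fastforce simp: disjoint_family_on_def W_def)
    fix e assume "e \<in> out_arcs G u"
    then have "S e ` W e \<subseteq> U u" using sub by blast
    then have "bounded (S e ` W e)" using U_bounded[OF assms] bounded_subset by blast
    then show "emeasure lborel (S e ` W e) \<noteq> \<infinity>"
      using emeasure_bounded_finite by (metis less_irrefl)
  qed simp
  also have "\<dots> \<le> measure lborel (U u \<inter> ball x \<rho>)"
    using sub open_image fmeasurable_U_Int[OF assms] by (intro measure_mono_fmeasurable) auto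
  finally show ?thesis by (simp add: W_def)
qed

text \<open>
  The mass distribution principle, without constructing a mass distribution. Each ball
  \<open>ball y \<tau>\<close> is assigned \<open>mass u y \<tau> = C * \<tau> powr (s - n) * vol (U u \<inter> ball y (R * \<tau>))\<close>. Rescaling by the
  edges leaving \<open>u\<close> can only decrease the total mass (\<open>split_mass\<close>), because volume scales with
  exponent \<open>n\<close> and the pieces are disjoint. A ball of radius at least 1 that meets \<open>F u\<close> already has mass at
  least \<open>h u\<close> (\<open>big\<close>). Given a finite cover, the balls are therefore magnified along the edges until
  one of them has radius at least 1, which is an induction on the number of magnifications. Since
  \<open>vol (ball y (R * \<tau>))\<close> is proportional to \<open>\<tau> ^ n\<close>, the mass is at most a multiple of \<open>\<tau> powr s\<close>.
\<close>

lemma weight_le_ball_cover: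
  assumes "0 < s" and inv: "\<forall>u\<in>verts G. 0 < h u \<and> h u = transfer s h u"
  shows "\<exists>K>0. \<forall>u\<in>verts G. \<forall>(I :: nat set) x \<rho>. finite I \<longrightarrow> F u \<subseteq> (\<Union>i\<in>I. ball (x i) (\<rho> i))
       \<longrightarrow> (\<forall>i\<in>I. 0 < \<rho> i \<and> \<rho> i \<le> 1) \<longrightarrow> h u \<le> K * (\<Sum>i\<in>I. \<rho> i powr s)"
proof -
  note h = bspec[OF inv]
  let ?N = "CARD('n)"
  obtain m M where m: "0 < m" "m \<le> 1" "\<And>e. e \<in> arcs G \<Longrightarrow> m \<le> r e"
    and M: "0 < M" "M < 1" "\<And>e. e \<in> arcs G \<Longrightarrow> r e \<le> M"
    using ratio_bounds by metis
  have "bounded (\<Union>u\<in>verts G. F u \<union> U u)"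
    using F_bounded U_bounded by auto
  then obtain b where "0 < b" and b: "\<And>u x. u \<in> verts G \<Longrightarrow> x \<in> F u \<union> U u \<Longrightarrow> norm x \<le> b"
    by (auto simp: bounded_pos)
  define R where "R = 1 + 2 * b"
  \<comment> \<open>\<open>R\<close> makes a ball of radius at least 1 that meets \<open>F u\<close> swallow \<open>U u\<close> when magnified by \<open>R\<close>;
    \<open>C\<close> then makes its mass at least \<open>h u\<close>. The bound \<open>1 / m\<close> on the radius is what a ball of radius
    less than 1 can reach in one magnification.\<close>
  define C where "C = (\<Sum>u\<in>verts G. h u / (m ^ ?N * measure lborel (U u)))"
  have term_pos: "0 < h u / (m ^ ?N * measure lborel (U u))" if "u \<in> verts G" for u
    using h[OF that] m(1) measure_U_pos[OF that] by (intro divide_pos_pos mult_pos_pos) simp_all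
  then have C_pos: "0 < C"
    unfolding C_def using verts_nonempty by (intro sum_pos) auto
  have h_le: "h u \<le> C * (m ^ ?N * measure lborel (U u))" if u: "u \<in> verts G" for u
  proof -
    have "h u / (m ^ ?N * measure lborel (U u)) \<le> C"
      unfolding C_def using term_pos u by (intro member_le_sum) (auto intro: less_imp_le)
    then show ?thesis
      using measure_U_pos[OF u] m by (simp add: divide_le_eq)
  qed
  define mass where "mass u y \<tau> = C * \<tau> powr (s - ?N) * measure lborel (U u \<inter> ball y (R * \<tau>))" for u y \<tau>
  have mass_nonneg: "0 \<le> mass u y \<tau>" for u y \<tau>
    using C_pos by (simp add: mass_def)
  have big: "h u \<le> mass u y \<tau>" if u: "u \<in> verts G" and \<tau>: "1 \<le> \<tau>" "\<tau> \<le> 1 / m"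
    and meet: "F u \<inter> ball y \<tau> \<noteq> {}" for u y \<tau>
  proof -
    obtain z where z: "z \<in> F u" "dist y z < \<tau>" using meet by auto
    have "U u \<subseteq> ball y (R * \<tau>)"
    proof
      fix x assume "x \<in> U u"
      have "dist y x \<le> dist y z + dist z x" by (rule dist_triangle)
      also have "dist z x \<le> norm z + norm x" by (simp add: dist_norm norm_triangle_ineq4)
      also have "\<dots> \<le> 2 * b" using b[OF u] z \<open>x \<in> U u\<close> by (metis UnI1 UnI2 add_mono mult_2)
      also have "dist y z + 2 * b < \<tau> + 2 * b" using z by simp
      also have "\<dots> \<le> R * \<tau>" using \<tau> \<open>0 < b\<close> by (simp add: R_def algebra_simps)
      finally show "x \<in> ball y (R * \<tau>)" by simp
    qed
    then have *: "U u \<inter> ball y (R * \<tau>) = U u" by auto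
    have "m ^ ?N \<le> (1 / \<tau>) ^ ?N"
      using \<tau> m by (intro power_mono) (auto simp: field_simps)
    also have "\<dots> = \<tau> powr (- real ?N)"
      using \<tau> by (simp add: powr_minus powr_realpow power_inverse divide_inverse)
    also have "\<dots> \<le> \<tau> powr (s - ?N)"
      using \<tau> \<open>0 < s\<close> by (intro powr_mono) auto
    finally have "C * (m ^ ?N * measure lborel (U u)) \<le> C * (\<tau> powr (s - ?N) * measure lborel (U u))"
      using C_pos by (intro mult_left_mono mult_right_mono) auto
    then show ?thesis using h_le[OF u] by (simp add: mass_def * mult.assoc)
  qed
  have split_mass: "(\<Sum>e\<in>out_arcs G u. r e powr s * mass (head G e) (y e) (\<tau> / r e)) \<le> mass u z \<tau>"
    if u: "u \<in> verts G" and "0 < \<tau>" and y: "\<And>e. e \<in> out_arcs G u \<Longrightarrow> S e (y e) = z" for u z \<tau> y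
  proof -
    have "r e powr s * mass (head G e) (y e) (\<tau> / r e) = C * \<tau> powr (s - ?N) *
       (r e ^ ?N * measure lborel (U (head G e) \<inter> S e -` ball z (R * \<tau>)))" if e: "e \<in> out_arcs G u" for e
    proof -
      note sim = out_arc_similarity(2,1)[OF e]
      have "S e -` ball z (R * \<tau>) = ball (y e) (R * (\<tau> / r e))"
        using similarity_vimage_ball[OF sim, of "y e" "R * \<tau>"] y[OF e] by simp
      moreover have "r e powr s * (\<tau> / r e) powr (s - ?N) = \<tau> powr (s - ?N) * r e ^ ?N"
        using sim(1) \<open>0 < \<tau>\<close> by (simp add: powr_divide powr_diff powr_realpow)
      ultimately show ?thesis by (simp add: mass_def)
    qed
    then have "(\<Sum>e\<in>out_arcs G u. r e powr s * mass (head G e) (y e) (\<tau> / r e)) = C * \<tau> powr (s - ?N) *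
       (\<Sum>e\<in>out_arcs G u. r e ^ ?N * measure lborel (U (head G e) \<inter> S e -` ball z (R * \<tau>)))"
      by (simp add: sum_distrib_left)
    also have "\<dots> \<le> mass u z \<tau>"
      unfolding mass_def using C_pos by (intro mult_left_mono measure_pieces_le u) auto
    finally show ?thesis .
  qed
  have key: "h u \<le> (\<Sum>i\<in>I. mass u (x i) (\<rho> i))"
    if "u \<in> verts G" "finite I" "F u \<subseteq> (\<Union>i\<in>I. ball (x i) (\<rho> i))"
      "\<And>i. i \<in> I \<Longrightarrow> M ^ n \<le> \<rho> i \<and> \<rho> i \<le> 1 / m" for n u x \<rho> and I :: "nat set"
    using that
  proof (induction n arbitrary: u x \<rho> I)
    case 0
    obtain z where "z \<in> F u" using F_ne[OF 0(1)] by auto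
    then obtain i where i: "i \<in> I" "F u \<inter> ball (x i) (\<rho> i) \<noteq> {}" using 0(3) by blast
    then have "h u \<le> mass u (x i) (\<rho> i)" using 0 by (intro big) auto
    also have "\<dots> \<le> (\<Sum>i\<in>I. mass u (x i) (\<rho> i))"
      using i 0 mass_nonneg by (intro member_le_sum) auto
    finally show ?case .
  next
    case (Suc n)
    \<comment> \<open>Balls that miss \<open>F u\<close> must be discarded first: a ball of radius at least 1 among them need
      neither have mass at least \<open>h u\<close> nor keep its radius below \<open>1 / m\<close> when magnified.\<close>
    define J where "J = {i \<in> I. F u \<inter> ball (x i) (\<rho> i) \<noteq> {}}"
    have "finite J" using Suc by (simp add: J_def)
    have "h u \<le> (\<Sum>i\<in>J. mass u (x i) (\<rho> i))"
    proof (cases "\<exists>i\<in>J. 1 \<le> \<rho> i")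
      case True
      then obtain i where i: "i \<in> J" "1 \<le> \<rho> i" by auto
      then have "h u \<le> mass u (x i) (\<rho> i)" using Suc by (intro big) (auto simp: J_def)
      also have "\<dots> \<le> (\<Sum>i\<in>J. mass u (x i) (\<rho> i))"
        using i \<open>finite J\<close> mass_nonneg by (intro member_le_sum) auto
      finally show ?thesis .
    next
      case False
      have \<rho>_pos: "0 < \<rho> i" if "i \<in> J" for i
        using Suc.prems(4)[of i] that M(1) less_le_trans[of 0 "M ^ Suc n" "\<rho> i"] by (simp add: J_def)
      have "\<exists>y. S e y = x i" if "e \<in> out_arcs G u" for e i
        using surjD[OF similarity_surj[OF out_arc_similarity(2,1)[OF that]]] by metis
      then obtain y where y: "\<And>e i. e \<in> out_arcs G u \<Longrightarrow> S e (y e i) = x i" by metis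
      have IH: "h (head G e) \<le> (\<Sum>i\<in>J. mass (head G e) (y e i) (\<rho> i / r e))"
        if e: "e \<in> out_arcs G u" for e
      proof (rule Suc.IH)
        note sim = out_arc_similarity(2,1)[OF e]
        show "F (head G e) \<subseteq> (\<Union>i\<in>J. ball (y e i) (\<rho> i / r e))"
        proof
          fix z assume "z \<in> F (head G e)"
          then have "S e z \<in> F u" using F_eq[OF Suc.prems(1)] e by blast
          then obtain i where "i \<in> J" "S e z \<in> ball (x i) (\<rho> i)"
            using Suc.prems(3) unfolding J_def by blast
          then have "z \<in> S e -` ball (S e (y e i)) (\<rho> i)" using y[OF e] by simp
          then have "z \<in> ball (y e i) (\<rho> i / r e)"
            unfolding similarity_vimage_ball[OF sim] .
          then show "z \<in> (\<Union>i\<in>J. ball (y e i) (\<rho> i / r e))" using \<open>i \<in> J\<close> by blast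
        qed
        fix i assume i: "i \<in> J"
        have "m \<le> r e" "r e \<le> M" using e m(3) M(3) by auto
        have "M ^ n * r e \<le> M ^ n * M" using \<open>r e \<le> M\<close> M by (intro mult_left_mono) auto
        also have "\<dots> \<le> \<rho> i" using i Suc.prems(4)[of i] by (simp add: J_def mult.commute)
        finally have "M ^ n \<le> \<rho> i / r e" using sim(1) by (simp add: le_divide_eq)
        moreover have "\<rho> i / r e \<le> 1 / m"
          using False i \<open>m \<le> r e\<close> m \<rho>_pos[OF i] by (intro frac_le) auto
        ultimately show "M ^ n \<le> \<rho> i / r e \<and> \<rho> i / r e \<le> 1 / m" by simp
      qed (use e \<open>finite J\<close> in auto)
      have "h u = transfer s h u" using h Suc.prems(1) by blast
      also have "\<dots> \<le> (\<Sum>e\<in>out_arcs G u. r e powr s *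
          (\<Sum>i\<in>J. mass (head G e) (y e i) (\<rho> i / r e)))"
        unfolding transfer_def using IH by (intro sum_mono mult_left_mono) auto
      also have "\<dots> = (\<Sum>i\<in>J. \<Sum>e\<in>out_arcs G u. r e powr s *
          mass (head G e) (y e i) (\<rho> i / r e))"
        unfolding sum_distrib_left by (rule sum.swap)
      also have "\<dots> \<le> (\<Sum>i\<in>J. mass u (x i) (\<rho> i))"
        using \<rho>_pos y by (intro sum_mono split_mass Suc.prems) auto
      finally show ?thesis .
    qed
    also have "\<dots> \<le> (\<Sum>i\<in>I. mass u (x i) (\<rho> i))"
      using Suc.prems mass_nonneg by (intro sum_mono2) (auto simp: J_def)
    finally show ?case .
  qed
  define K where "K = C * (unit_ball_vol ?N * R ^ ?N)"
  have "0 < R" using \<open>0 < b\<close> by (simp add: R_def)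
  have mass_le: "mass u y \<tau> \<le> K * \<tau> powr s" if u: "u \<in> verts G" and "0 < \<tau>" for u y \<tau>
  proof -
    have "measure lborel (U u \<inter> ball y (R * \<tau>)) \<le> measure lborel (ball y (R * \<tau>))"
      using U_open[OF u] by (intro measure_mono_fmeasurable) (auto intro!: fmeasurableI emeasure_bounded_finite)
    also have "\<dots> = unit_ball_vol ?N * (R * \<tau>) ^ ?N"
      using \<open>0 < R\<close> \<open>0 < \<tau>\<close> by (simp add: content_ball)
    finally have "mass u y \<tau> \<le> C * \<tau> powr (s - ?N) * (unit_ball_vol ?N * (R * \<tau>) ^ ?N)"
      unfolding mass_def using C_pos by (intro mult_left_mono) auto
    also have "\<dots> = K * (\<tau> powr (s - ?N) * \<tau> ^ ?N)"
      by (simp add: K_def power_mult_distrib)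
    also have "\<tau> powr (s - ?N) * \<tau> ^ ?N = \<tau> powr s"
      using \<open>0 < \<tau>\<close> by (simp add: powr_diff powr_realpow)
    finally show ?thesis .
  qed
  show ?thesis
  proof (intro exI[of _ K] conjI ballI allI impI)
    show "0 < K" using C_pos \<open>0 < R\<close> by (simp add: K_def)
    fix u :: 'v and I :: "nat set" and x \<rho>
    assume u: "u \<in> verts G" and I: "finite I" "F u \<subseteq> (\<Union>i\<in>I. ball (x i) (\<rho> i))"
      and \<rho>: "\<forall>i\<in>I. 0 < \<rho> i \<and> \<rho> i \<le> 1"
    have "\<forall>\<^sub>F n in sequentially. \<forall>i\<in>I. M ^ n < \<rho> i"
      using I \<rho> M by (intro eventually_ball_finite ballI order_tendstoD(2)[OF LIMSEQ_realpow_zero]) auto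
    then obtain n where "\<forall>i\<in>I. M ^ n < \<rho> i"
      using eventually_happens'[of sequentially] by auto
    moreover have "1 \<le> 1 / m" using m by simp
    ultimately have "h u \<le> (\<Sum>i\<in>I. mass u (x i) (\<rho> i))"
      using \<rho> by (intro key[OF u I, of n]) (fastforce intro: less_imp_le order_trans)
    also have "\<dots> \<le> (\<Sum>i\<in>I. K * \<rho> i powr s)"
      using \<rho> by (intro sum_mono mass_le u) auto
    finally show "h u \<le> K * (\<Sum>i\<in>I. \<rho> i powr s)" by (simp add: sum_distrib_left)
  qed
qed

text \<open>
  An arbitrary countable cover is turned into a cover by slightly larger open balls, of which
  finitely many suffice by compactness. The scale \<open>1/2\<close> leaves room to enlarge the radii while keeping
  them at most 1.
\<close>

lemma hausdorff_content_attractor_pos: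
  assumes "0 < s" and inv: "\<forall>u\<in>verts G. 0 < h u \<and> h u = transfer s h u"
    and u: "u \<in> verts G"
  shows "0 < hausdorff_content s (1/2) (F u)"
proof -
  obtain K where "0 < K"
    and K: "\<forall>u\<in>verts G. \<forall>(I :: nat set) x \<rho>. finite I \<longrightarrow> F u \<subseteq> (\<Union>i\<in>I. ball (x i) (\<rho> i))
       \<longrightarrow> (\<forall>i\<in>I. 0 < \<rho> i \<and> \<rho> i \<le> 1) \<longrightarrow> h u \<le> K * (\<Sum>i\<in>I. \<rho> i powr s)"
    using weight_le_ball_cover[OF assms(1) inv] by blast
  have "ennreal (h u / K) \<le> (\<Sum>i. diam_power s (V i))" if V: "V \<in> delta_covers (1/2) (F u)" for V
  proof (rule ennreal_le_epsilon)
    fix e0 :: real assume "0 < e0"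
    have V': "F u \<subseteq> (\<Union>i. V i)" "bounded (V i)" "diameter (V i) \<le> 1/2" for i
      using V by (auto simp: delta_covers_def)
    \<comment> \<open>The slack must be small enough that \<open>d i \<le> 1\<close> below, given \<open>diameter (V i) \<le> 1/2\<close>.\<close>
    define e where "e = min e0 (1 - (1/2) powr s)"
    have "(1/2::real) powr s < 1 powr s" using \<open>0 < s\<close> by (intro powr_less_mono2) auto
    then have "0 < e" "e \<le> e0" "e \<le> 1 - (1/2) powr s" using \<open>0 < e0\<close> by (auto simp: e_def)
    define d where "d i = diameter (V i) powr s + e * (1/2) ^ Suc i" for i
    define \<rho> where "\<rho> i = d i powr (1 / s)" for i
    have d_pos: "0 < d i" for i using \<open>0 < e\<close> by (auto simp: d_def intro!: add_nonneg_pos)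
    have \<rho>s: "\<rho> i powr s = d i" for i
      using d_pos[of i] \<open>0 < s\<close> by (simp add: \<rho>_def powr_powr)
    have "d i \<le> 1" for i
    proof -
      have "diameter (V i) powr s \<le> (1/2) powr s"
        using V' \<open>0 < s\<close> by (intro powr_mono2) (auto intro: diameter_ge_0)
      moreover have "e * (1/2) ^ Suc i \<le> e * 1"
        using \<open>0 < e\<close> by (intro mult_left_mono power_le_one) auto
      ultimately show ?thesis using \<open>e \<le> 1 - (1/2) powr s\<close> by (simp add: d_def)
    qed
    then have "\<rho> i \<le> 1" for i
      unfolding \<rho>_def using \<open>0 < s\<close> less_imp_le[OF d_pos[of i]] by (intro powr_le1) auto
    moreover have "0 < \<rho> i" for i using d_pos[of i] by (simp add: \<rho>_def)
    ultimately have \<rho>: "0 < \<rho> i \<and> \<rho> i \<le> 1" for i by simp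
    have diam: "diameter (V i) < \<rho> i" for i
    proof (rule ccontr)
      assume "\<not> ?thesis"
      then have "\<rho> i powr s \<le> diameter (V i) powr s"
        using \<rho>[of i] \<open>0 < s\<close> by (intro powr_mono2) auto
      moreover have "0 < e * (1/2) ^ Suc i" using \<open>0 < e\<close> by simp
      ultimately show False unfolding \<rho>s d_def by linarith
    qed
    \<comment> \<open>For empty \<open>V i\<close> the centre is arbitrary; the extra ball only costs \<open>e * (1/2) ^ Suc i\<close>.\<close>
    define x where "x i = (SOME y. y \<in> V i)" for i
    have sub: "V i \<subseteq> ball (x i) (\<rho> i)" for i
    proof
      fix y assume "y \<in> V i"
      then have "x i \<in> V i" unfolding x_def by (rule someI)
      then have "dist (x i) y \<le> diameter (V i)"
        using \<open>y \<in> V i\<close> V' by (intro diameter_bounded_bound) auto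
      then show "y \<in> ball (x i) (\<rho> i)" using diam[of i] by simp
    qed
    have "F u \<subseteq> (\<Union>i\<in>UNIV. ball (x i) (\<rho> i))" using V'(1) sub by blast
    then obtain I where I: "finite I" "F u \<subseteq> (\<Union>i\<in>I. ball (x i) (\<rho> i))"
      using compactE_image[OF F_compact[OF u], of UNIV "\<lambda>i. ball (x i) (\<rho> i)"] by auto
    have "h u \<le> K * (\<Sum>i\<in>I. \<rho> i powr s)" using K u I \<rho> by blast
    then have "h u / K \<le> (\<Sum>i\<in>I. d i)" using \<open>0 < K\<close> by (simp add: \<rho>s divide_le_eq mult.commute)
    then have "ennreal (h u / K) \<le> (\<Sum>i\<in>I. ennreal (d i))"
      using d_pos by (subst sum_ennreal) (auto intro: less_imp_le ennreal_leI)
    also have "\<dots> \<le> (\<Sum>i. ennreal (d i))"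
      using I by (intro sum_le_suminf) auto
    also have "\<dots> = (\<Sum>i. diam_power s (V i) + ennreal (e * (1/2) ^ Suc i))"
      using \<open>0 < s\<close> \<open>0 < e\<close> by (simp add: d_def diam_power_pos del: power_Suc)
    also have "\<dots> = (\<Sum>i. diam_power s (V i)) + (\<Sum>i. ennreal (e * (1/2) ^ Suc i))"
      by (rule suminf_add[symmetric]) auto
    also have "(\<Sum>i. ennreal (e * (1/2)^Suc i)) = ennreal e"
      using sums_mult[OF power_half_series, of e] \<open>0 < e\<close> by (intro suminf_ennreal_eq) auto
    also have "(\<Sum>i. diam_power s (V i)) + ennreal e \<le> (\<Sum>i. diam_power s (V i)) + ennreal e0"
      using \<open>e \<le> e0\<close> by (intro add_left_mono ennreal_leI)
    finally show "ennreal (h u / K) \<le> (\<Sum>i. diam_power s (V i)) + ennreal e0" .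
  qed
  then have "ennreal (h u / K) \<le> hausdorff_content s (1/2) (F u)"
    unfolding hausdorff_content_def by (rule INF_greatest)
  moreover have "0 < h u" using inv u by blast
  then have "0 < ennreal (h u / K)" using \<open>0 < K\<close> by simp
  ultimately show ?thesis by (rule less_le_trans[rotated])
qed

section \<open>Measure equals content\<close>

lemma hausdorff_content_step:
  assumes "0 \<le> s" "0 \<le> \<delta>" "u \<in> verts G"
  shows "hausdorff_content s \<delta> (F u)
     \<le> (\<Sum>e\<in>out_arcs G u. ennreal (r e powr s) * hausdorff_content s (\<delta> / r e) (F (head G e)))"
proof -
  have "hausdorff_content s \<delta> (F u) = hausdorff_content s \<delta> (\<Union>e\<in>out_arcs G u. S e ` F (head G e))"
    using F_eq[OF assms(3)] by simp
  also have "\<dots> \<le> (\<Sum>e\<in>out_arcs G u. hausdorff_content s \<delta> (S e ` F (head G e)))"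
    using assms by (intro hausdorff_content_UN_finite_le) auto
  also have "\<dots> \<le> (\<Sum>e\<in>out_arcs G u. ennreal (r e powr s) * hausdorff_content s (\<delta> / r e) (F (head G e)))"
    using assms out_arc_similarity by (intro sum_mono hausdorff_content_similarity_image_le) auto
  finally show ?thesis .
qed

text \<open>
  Scales above \<open>D\<close> are reached in the inequality for \<open>c\<close>, because pulling back along an edge
  enlarges the scale; replacing such a scale by \<open>D\<close> can only increase the content. Invariance of \<open>c\<close>
  then shows by induction that the content at scale \<open>D * M ^ k\<close> does not exceed \<open>c\<close>, where \<open>M < 1\<close>
  bounds all ratios.
\<close>

lemma hausdorff_measure_eq_content:
  assumes "0 < s" and inv: "\<forall>u\<in>verts G. 0 < h u \<and> h u = transfer s h u"
    and "0 < D" and D: "\<And>u. u \<in> verts G \<Longrightarrow> diameter (F u) \<le> D" and u: "u \<in> verts G"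
  shows "hausdorff_measure s (F u) = hausdorff_content s D (F u)"
    and "hausdorff_content s D (F u) < top"
proof -
  note h = bspec[OF inv]
  have fin: "hausdorff_content s D (F v) < top" if "v \<in> verts G" for v
  proof -
    have "hausdorff_content s D (F v) \<le> diam_power s (F v)"
      using F_bounded[OF that] D[OF that] \<open>0 < D\<close> by (intro hausdorff_content_le_diam_power) auto
    then show ?thesis using \<open>0 < s\<close> by (auto simp: diam_power_pos intro: le_less_trans)
  qed
  then show "hausdorff_content s D (F u) < top" using u by simp
  define c where "c v = enn2real (hausdorff_content s D (F v))" for v
  have c: "hausdorff_content s D (F v) = ennreal (c v)" if "v \<in> verts G" for v
    using fin[OF that] by (simp add: c_def)
  have c_nonneg: "0 \<le> c v" for v by (simp add: c_def)
  have transfer_c: "(\<Sum>e\<in>out_arcs G v. ennreal (r e powr s) * hausdorff_content s D (F (head G e)))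
      = ennreal (transfer s c v)" for v
  proof -
    have "(\<Sum>e\<in>out_arcs G v. ennreal (r e powr s) * hausdorff_content s D (F (head G e)))
      = (\<Sum>e\<in>out_arcs G v. ennreal (r e powr s * c (head G e)))"
      by (intro sum.cong) (simp_all add: c ennreal_mult c_nonneg)
    also have "\<dots> = ennreal (transfer s c v)"
      unfolding transfer_def by (intro sum_ennreal) (simp add: c_nonneg)
    finally show ?thesis .
  qed
  have enlarge: "hausdorff_content s (\<delta> / r e) A \<le> hausdorff_content s \<epsilon> A"
    if "e \<in> out_arcs G v" "\<epsilon> * r e \<le> \<delta>" for e v \<delta> \<epsilon> and A :: "(real ^ 'n) set"
    using that out_arc_ratio[OF that(1)] by (intro hausdorff_content_antimono) (simp add: le_divide_eq)
  have sub: "c v \<le> transfer s c v" if v: "v \<in> verts G" for v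
  proof -
    have "ennreal (c v) \<le> (\<Sum>e\<in>out_arcs G v. ennreal (r e powr s) * hausdorff_content s (D / r e) (F (head G e)))"
      using hausdorff_content_step[of s D v] assms v by (simp add: c)
    also have "\<dots> \<le> (\<Sum>e\<in>out_arcs G v. ennreal (r e powr s) * hausdorff_content s D (F (head G e)))"
      using out_arc_ratio \<open>0 < D\<close>
      by (intro sum_mono mult_left_mono enlarge) (auto intro!: mult_left_le less_imp_le)
    also have "\<dots> = ennreal (transfer s c v)" by (rule transfer_c)
    finally show ?thesis
      by (subst (asm) ennreal_le_iff) (auto simp: transfer_def c_nonneg intro!: sum_nonneg)
  qed
  obtain \<theta> where \<theta>: "\<And>v. v \<in> verts G \<Longrightarrow> c v = \<theta> * h v"
    using subinvariant_proportional[of h s c] h sub by blast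
  have c_inv: "transfer s c v = c v" if v: "v \<in> verts G" for v
  proof -
    have "transfer s c v = transfer s (\<lambda>v. \<theta> * h v) v"
      unfolding transfer_def using \<theta> by (intro sum.cong) auto
    also have "\<dots> = c v" using \<theta>[OF v] h[OF v] by (simp add: transfer_cmult)
    finally show ?thesis .
  qed
  obtain m M where M: "0 < M" "M < 1" "\<And>e. e \<in> arcs G \<Longrightarrow> r e \<le> M"
    using ratio_bounds by metis
  have scale: "hausdorff_content s (D * M ^ k) (F v) \<le> ennreal (c v)" if "v \<in> verts G" for k v
    using that
  proof (induction k arbitrary: v)
    case 0
    then show ?case by (simp add: c)
  next
    case (Suc k)
    have "hausdorff_content s (D * M ^ Suc k) (F v) \<le> (\<Sum>e\<in>out_arcs G v. ennreal (r e powr s) *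
        hausdorff_content s (D * M ^ Suc k / r e) (F (head G e)))"
      using assms M Suc.prems by (intro hausdorff_content_step) auto
    also have "\<dots> \<le> (\<Sum>e\<in>out_arcs G v. ennreal (r e powr s) * hausdorff_content s (D * M ^ k) (F (head G e)))"
      using M \<open>0 < D\<close> by (intro sum_mono mult_left_mono enlarge) (auto simp: mult_ac)
    also have "\<dots> \<le> (\<Sum>e\<in>out_arcs G v. ennreal (r e powr s) * hausdorff_content s D (F (head G e)))"
      using Suc.IH by (intro sum_mono mult_left_mono) (auto simp: c)
    also have "\<dots> = ennreal (c v)" using transfer_c c_inv[OF Suc.prems] by simp
    finally show ?case .
  qed
  have "hausdorff_measure s (F u) \<le> ennreal (c u)"
  proof (rule hausdorff_measure_leI)
    fix \<delta> :: real assume "0 < \<delta>"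
    have "(\<lambda>k. D * M ^ k) \<longlonglongrightarrow> D * 0"
      using M by (intro tendsto_intros LIMSEQ_realpow_zero) auto
    then have "\<forall>\<^sub>F k in sequentially. D * M ^ k < \<delta>"
      using \<open>0 < \<delta>\<close> by (intro order_tendstoD(2)) auto
    then obtain k where "D * M ^ k < \<delta>"
      using eventually_happens'[of sequentially] by auto
    then have "hausdorff_content s \<delta> (F u) \<le> hausdorff_content s (D * M ^ k) (F u)"
      by (intro hausdorff_content_antimono) auto
    then show "hausdorff_content s \<delta> (F u) \<le> ennreal (c u)" using scale[OF u] order_trans by blast
  qed
  then show "hausdorff_measure s (F u) = hausdorff_content s D (F u)"
    unfolding c[OF u, symmetric] by (rule antisym) (rule hausdorff_content_le_measure[OF \<open>0 < D\<close>])
qed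

text \<open>
  The exponent is obtained from the graph alone; that it is the Hausdorff dimension follows
  from positivity and finiteness of the measure. Measurability of \<open>A\<close> enters through the additivity
  that lets the measure of \<open>F u - A\<close> be cancelled.
\<close>

lemma attractor_measure_content:
  "\<exists>s>0. \<forall>u\<in>verts G. 0 < hausdorff_measure s (F u) \<and> hausdorff_measure s (F u) < top \<and>
     (\<forall>A. A \<subseteq> F u \<longrightarrow> hausdorff_measurable s A \<longrightarrow> hausdorff_measure s A \<le> ennreal (diameter A powr s))"
proof -
  obtain s h where "0 < s" and inv: "\<forall>u\<in>verts G. 0 < h u \<and> h u = transfer s h u"
    using ex_invariant_weights by blast
  define D where "D = (\<Sum>u\<in>verts G. diameter (F u)) + 1"
  have D: "0 < D" "\<And>u. u \<in> verts G \<Longrightarrow> diameter (F u) \<le> D"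
  proof -
    have "diameter (F u) \<le> (\<Sum>u\<in>verts G. diameter (F u))" if "u \<in> verts G" for u
      using that F_bounded by (intro member_le_sum) (auto intro: diameter_ge_0)
    then show "\<And>u. u \<in> verts G \<Longrightarrow> diameter (F u) \<le> D" by (force simp: D_def)
    have "0 \<le> (\<Sum>u\<in>verts G. diameter (F u))"
      using F_bounded by (intro sum_nonneg) (auto intro: diameter_ge_0)
    then show "0 < D" by (simp add: D_def)
  qed
  have eq: "hausdorff_measure s (F u) = hausdorff_content s D (F u)" "hausdorff_content s D (F u) < top"
    if "u \<in> verts G" for u
    using hausdorff_measure_eq_content[OF \<open>0 < s\<close> inv _ _ that, of D] D by blast+
  show ?thesis
  proof (intro exI[of _ s] conjI ballI allI impI)
    show "0 < s" by fact
    fix u assume u: "u \<in> verts G"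
    show "0 < hausdorff_measure s (F u)"
      using hausdorff_content_attractor_pos[OF \<open>0 < s\<close> inv u]
        hausdorff_content_le_measure[of "1/2" s "F u"] by (auto intro: less_le_trans)
    show "hausdorff_measure s (F u) < top" using eq[OF u] by simp
    fix A assume A: "A \<subseteq> F u" "hausdorff_measurable s A"
    have bdd: "bounded A" "diameter A \<le> D"
      using A F_bounded[OF u] D(2)[OF u] diameter_subset[of A "F u"] bounded_subset by auto
    have "hausdorff_measure s A + hausdorff_measure s (F u - A) = hausdorff_measure s (F u)"
    proof -
      have "hausdorff_measure s (A \<inter> F u) + hausdorff_measure s ((UNIV - A) \<inter> F u) = hausdorff_measure s (F u)"
        using A(2) by (auto simp: hausdorff_measurable_def lambda_system_def)
      moreover have "A \<inter> F u = A" "(UNIV - A) \<inter> F u = F u - A" using A by auto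
      ultimately show ?thesis by simp
    qed
    also have "\<dots> = hausdorff_content s D (A \<union> (F u - A))" using eq[OF u] A by (simp add: Un_absorb1)
    also have "\<dots> \<le> hausdorff_content s D A + hausdorff_content s D (F u - A)"
      using hausdorff_content_UN_finite_le[of "{True, False}" D s "\<lambda>b. if b then A else F u - A"] D(1)
      by (simp add: Un_commute)
    also have "\<dots> \<le> ennreal (diameter A powr s) + hausdorff_measure s (F u - A)"
      using hausdorff_content_le_diam_power[OF bdd, of s] hausdorff_content_le_measure[OF D(1)] D(1) \<open>0 < s\<close>
      by (intro add_mono) (auto simp: diam_power_pos)
    finally have "hausdorff_measure s (F u - A) + hausdorff_measure s A
        \<le> hausdorff_measure s (F u - A) + ennreal (diameter A powr s)"
      by (simp add: add.commute)
    moreover have "hausdorff_measure s (F u - A) < top"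
      using hausdorff_measure_mono[of "F u - A" "F u" s] eq[OF u] by (auto intro: le_less_trans)
    ultimately show "hausdorff_measure s A \<le> ennreal (diameter A powr s)"
      by (auto simp: ennreal_add_left_cancel_le)
  qed
qed

end

section \<open>Densities\<close>

text \<open>
  Replacing the sets of a cover of \<open>E\<close> by the traces of their closures on \<open>E\<close> makes them measurable
  subsets of \<open>E\<close> without increasing diameters. If all densities were at most \<open>\<sigma> < 1\<close>, the measure of
  \<open>E\<close> would be at most \<open>\<sigma>\<close> times the content of \<open>E\<close>, hence less than itself. The isodiametric assumption
  serves for the sets of diameter 0, on which the supremum gives no information.
\<close>

lemma SUP_density_ge_1:
  fixes E :: "'a::metric_space set"
  assumes "closed E" "0 < s" "0 < hausdorff_measure s E" "hausdorff_measure s E < top"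
    and isodiametric: "\<And>A. A \<subseteq> E \<Longrightarrow> hausdorff_measurable s A \<Longrightarrow> hausdorff_measure s A \<le> ennreal (diameter A powr s)"
  shows "1 \<le> (SUP A \<in> {A. A \<subseteq> E \<and> hausdorff_measurable s A \<and> diameter A > 0}.
            hausdorff_measure s A / ennreal (diameter A powr s))" (is "_ \<le> ?\<sigma>")
proof (rule ccontr)
  assume "\<not> 1 \<le> ?\<sigma>"
  then have "?\<sigma> < 1" by simp
  define \<sigma> where "\<sigma> = ?\<sigma>"
  have density: "hausdorff_measure s A \<le> \<sigma> * ennreal (diameter A powr s)"
    if A: "A \<subseteq> E" "hausdorff_measurable s A" "bounded A" for A
  proof (cases "0 < diameter A")
    case True
    then have "hausdorff_measure s A / ennreal (diameter A powr s) \<le> \<sigma>"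
      unfolding \<sigma>_def using A by (intro SUP_upper) auto
    then have "hausdorff_measure s A / ennreal (diameter A powr s) * ennreal (diameter A powr s)
        \<le> \<sigma> * ennreal (diameter A powr s)" by (rule mult_right_mono) simp
    then show ?thesis
      using True by (simp add: ennreal_divide_times)
  next
    case False
    then have "diameter A = 0" using diameter_ge_0[OF A(3)] by simp
    then show ?thesis using isodiametric[OF A(1,2)] by simp
  qed
  have "hausdorff_measure s E \<le> \<sigma> * (\<Sum>i. diam_power s (V i))" if V: "V \<in> delta_covers 1 E" for V
  proof -
    have V': "E \<subseteq> (\<Union>i. V i)" "bounded (V i)" for i using V by (auto simp: delta_covers_def)
    define A where "A i = E \<inter> closure (V i)" for i
    have piece: "hausdorff_measure s (A i) \<le> \<sigma> * diam_power s (V i)" for i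
    proof -
      have bdd: "bounded (closure (V i))" using V'(2) by (rule bounded_closure)
      have "hausdorff_measurable s (A i)"
        unfolding A_def using \<open>closed E\<close> by (intro hausdorff_measurable_closed closed_Int) auto
      then have "hausdorff_measure s (A i) \<le> \<sigma> * ennreal (diameter (A i) powr s)"
        using bdd by (intro density) (auto simp: A_def)
      also have "\<dots> \<le> \<sigma> * diam_power s (V i)"
      proof -
        have "diameter (A i) \<le> diameter (closure (V i))"
          using bdd by (intro diameter_subset) (auto simp: A_def)
        also have "\<dots> = diameter (V i)" using V'(2) by (rule diameter_closure)
        finally have "diameter (A i) powr s \<le> diameter (V i) powr s"
          using \<open>0 < s\<close> bdd by (intro powr_mono2 diameter_ge_0) (auto simp: A_def)
        then show ?thesis using \<open>0 < s\<close> by (auto simp: diam_power_pos intro!: mult_left_mono)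
      qed
      finally show ?thesis .
    qed
    have "E \<subseteq> (\<Union>i. A i)"
    proof
      fix x assume "x \<in> E"
      then obtain i where "x \<in> V i" using V'(1) by blast
      then have "x \<in> A i" using \<open>x \<in> E\<close> closure_subset[of "V i"] unfolding A_def by blast
      then show "x \<in> (\<Union>i. A i)" by blast
    qed
    then have "hausdorff_measure s E \<le> hausdorff_measure s (\<Union>i. A i)" by (rule hausdorff_measure_mono)
    also have "\<dots> \<le> (\<Sum>i. hausdorff_measure s (A i))" by (rule hausdorff_measure_UN_le)
    also have "\<dots> \<le> (\<Sum>i. \<sigma> * diam_power s (V i))" using piece by (intro suminf_le) auto
    finally show ?thesis by simp
  qed
  note bound = this
  have "0 < \<sigma>"
  proof (rule ccontr)
    assume "\<not> 0 < \<sigma>"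
    have "hausdorff_content s 1 E < top"
      using hausdorff_content_le_measure[of 1 s E] assms(4) by (auto intro: le_less_trans)
    then obtain V where "V \<in> delta_covers 1 E"
      unfolding hausdorff_content_def by (auto simp: INF_less_iff)
    then show False using bound[of V] \<open>\<not> 0 < \<sigma>\<close> assms(3) by simp
  qed
  moreover have "\<sigma> < 1" using \<open>?\<sigma> < 1\<close> by (simp only: \<sigma>_def)
  then have "\<sigma> < top" by (rule less_trans) simp
  ultimately have "hausdorff_measure s E \<le> \<sigma> * hausdorff_content s 1 E"
    unfolding hausdorff_content_def using bound by (rule ennreal_le_mult_INF)
  also have "\<dots> \<le> \<sigma> * hausdorff_measure s E"
    by (intro mult_left_mono hausdorff_content_le_measure) auto
  also have "\<dots> < 1 * hausdorff_measure s E"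
    using \<open>\<sigma> < 1\<close> assms(3,4) by (intro ennreal_mult_strict_right_mono)
  finally show False by simp
qed

theorem corollary3p6:
  fixes G :: "('v, 'e) pre_digraph"
    and S :: "'e \<Rightarrow> real ^ 'n \<Rightarrow> real ^ 'n"
    and r :: "'e \<Rightarrow> real"
    and F :: "'v \<Rightarrow> (real ^ 'n) set"
    and s :: real
    and u w :: 'v
  assumes "digraph_IFS G S r"
    and "open_set_condition G S"
    and "is_attractor G S F"
    and "w \<in> verts G"
    and "s = hausdorff_dim (F w)"
    and "u \<in> verts G"
  shows "(\<forall>A. A \<subseteq> F u \<and> hausdorff_measurable s A \<longrightarrow>
            hausdorff_measure s A \<le> ennreal (diameter A powr s)) \<and>
         (SUP A \<in> {A. A \<subseteq> F u \<and> hausdorff_measurable s A \<and> diameter A > 0}.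
            hausdorff_measure s A / ennreal (diameter A powr s)) = 1"
proof -
  obtain U where U: "\<forall>u\<in>verts G.
        U u \<noteq> {} \<and> bounded (U u) \<and> open (U u) \<and>
        (\<forall>e\<in>out_arcs G u. S e ` U (head G e) \<subseteq> U u) \<and>
        (\<forall>e\<in>out_arcs G u. \<forall>f\<in>out_arcs G u.
           e \<noteq> f \<longrightarrow> S e ` U (head G e) \<inter> S f ` U (head G f) = {})"
    using assms(2) unfolding open_set_condition_def ..
  interpret osc_IFS G S r F U
    using assms(1,3) U by (intro osc_IFS.intro osc_IFS_axioms.intro) blast+
  obtain t where "0 < t"
    and t: "\<forall>u\<in>verts G. 0 < hausdorff_measure t (F u) \<and> hausdorff_measure t (F u) < top \<and>
     (\<forall>A. A \<subseteq> F u \<longrightarrow> hausdorff_measurable t A \<longrightarrow> hausdorff_measure t A \<le> ennreal (diameter A powr t))"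
    using attractor_measure_content by blast
  note meas = bspec[OF t]
  have "s = t"
    unfolding assms(5) using meas[OF assms(4)] by (intro hausdorff_dim_eqI[OF \<open>0 < t\<close>]) auto
  show ?thesis
  proof (intro conjI allI impI antisym)
    show "hausdorff_measure s A \<le> ennreal (diameter A powr s)"
      if "A \<subseteq> F u \<and> hausdorff_measurable s A" for A
      using meas[OF assms(6)] that \<open>s = t\<close> by blast
    show "(SUP A \<in> {A. A \<subseteq> F u \<and> hausdorff_measurable s A \<and> diameter A > 0}.
            hausdorff_measure s A / ennreal (diameter A powr s)) \<le> 1"
      using meas[OF assms(6)] \<open>s = t\<close>
      by (intro SUP_least divide_le_posI_ennreal) auto
    show "1 \<le> (SUP A \<in> {A. A \<subseteq> F u \<and> hausdorff_measurable s A \<and> diameter A > 0}.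
            hausdorff_measure s A / ennreal (diameter A powr s))"
      using \<open>s = t\<close> meas[OF assms(6)] \<open>0 < t\<close> F_compact[OF assms(6)]
      by (intro SUP_density_ge_1) (auto intro: compact_imp_closed)
  qed
qed

end
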